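(* The Banach space $$X=\Big(\sum_{m=1}^\infty\oplus\,\ell_1(\mathbb{N}\times\{m\})\Big)_2$$ (the $\ell_2$-sum of countably many copies of $\ell_1(\mathbb{N})$) does not have property ( * ), although it is SWKA and weakly sequentially complete. In particular, $X$ is not SWCG with respect to any Banach space.
   Context: Banach spaces are real. Property ( * ): for $\varepsilon\ge 0$, a bounded subset $M$ of a Banach space $X$ is $\varepsilon$-weakly relatively compact if $\overline{M}^{w^*}\subseteq X+\varepsilon B_{X^{**}}$ (closure in $(X^{**},w^* )$). $X$ has property ( * ) if there is a countable family $\{M_{n,p}: n,p\in\mathbb{N}\}$ of (convex and symmetric) subsets of $X$ such that each $M_{n,p}$ is $\frac1p$-weakly relatively compact, and for every $p\in\mathbb{N}$ and every weakly compact $L\subseteq X$ there is $n\in\mathbb{N}$ with $L\subseteq M_{n,p}$. SWKA: for a topological space $T$, $\mathcal{K}(T)$ denotes the set of nonempty compact subsets of $T$, and $\Sigma=\mathbb{N}^{\mathbb{N}}$ is the Baire space. $F\colon\Sigma\to\mathcal{K}(T)$ is usco if for every $\sigma\in\Sigma$ and open $V\supseteq F(\sigma)$ there is a neighbourhood $W$ of $\sigma$ with $\bigcup_{t\in W}F(t)\subseteq V$. $T$ is strongly $\mathcal{K}$-analytic if there is an usco map $F\colon\Sigma\to\mathcal{K}(T)$ with $\bigcup_{\sigma}F(\sigma)=T$ such that every compact $L\subseteq T$ is contained in some $F(\sigma)$. A Banach space $X$ is SWKA (strongly weakly $\mathcal{K}$-analytic) if $(X,w)$ is strongly $\mathcal{K}$-analytic.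 SWCG with respect to $Z$: for Banach spaces $X\subseteq Z$ ($X$ a closed subspace of $Z$), $X$ is SWCG with respect to $Z$ if there is a weakly compact (convex and symmetric) subset $K$ of $Z$ such that for each $\varepsilon>0$ and each weakly compact $L\subseteq X$ there is $n\in\mathbb{N}$ with $L\subseteq nK+\varepsilon B_Z$. Weakly sequentially complete means every weakly Cauchy sequence converges weakly. *)

theory Defs
  imports "HOL-Analysis.Analysis"
begin

section \<open>Weak and weak-star topologies\<close>

text \<open>The dual of \<open>'a\<close> is the type \<open>'a \<Rightarrow>\<^sub>L real\<close> and the bidual is
  \<open>('a \<Rightarrow>\<^sub>L real) \<Rightarrow>\<^sub>L real\<close>, both with the operator norm.\<close>

definition weak_topology :: "'a::real_normed_vector topology" where
  "weak_topology = pullback_topology UNIV (\<lambda>x (f::'a \<Rightarrow>\<^sub>L real). blinfun_apply f x) euclidean"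

text \<open>The library's strong operator topology is the topology of pointwise convergence;
  for scalar-valued operators this is the weak-star topology.\<close>

abbreviation weak_star_topology :: "('a::real_normed_vector \<Rightarrow>\<^sub>L real) topology" where
  "weak_star_topology \<equiv> strong_operator_topology"

lift_definition bidual_embedding :: "'a::real_normed_vector \<Rightarrow> (('a \<Rightarrow>\<^sub>L real) \<Rightarrow>\<^sub>L real)"
  is "\<lambda>x f. blinfun_apply f x"
  by (rule blinfun.bounded_linear_left)

abbreviation weakly_compact :: "'a::real_normed_vector set \<Rightarrow> bool" where
  "weakly_compact L \<equiv> compactin weak_topology L"


section \<open>The properties of Banach spaces\<close>

definition eps_weakly_relatively_compact :: "real \<Rightarrow> 'a::banach set \<Rightarrow> bool" where
  "eps_weakly_relatively_compact \<epsilon> M \<longleftrightarrow>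
     bounded M \<and>
     weak_star_topology closure_of (bidual_embedding ` M)
       \<subseteq> {bidual_embedding x + u | x u. u \<in> cball 0 \<epsilon>}"

text \<open>The sets \<open>M n p\<close> may equivalently be taken convex and symmetric (by the quantitative
  Krein theorem, up to reindexing \<open>p\<close>); this is not part of the definition, so that the negation
  of the property excludes arbitrary families, in particular convex symmetric ones.\<close>

definition property_star :: "'a::banach itself \<Rightarrow> bool" where
  "property_star _ \<longleftrightarrow>
     (\<exists>M :: nat \<Rightarrow> nat \<Rightarrow> 'a set.
        (\<forall>n. \<forall>p\<ge>1. eps_weakly_relatively_compact (1 / real p) (M n p)) \<and>
        (\<forall>p\<ge>1. \<forall>L. weakly_compact L \<longrightarrow> (\<exists>n. L \<subseteq> M n p)))"

text \<open>The Baire space is \<open>nat \<Rightarrow> nat\<close> with the library's product topology.\<close>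

definition usco :: "'a topology \<Rightarrow> ((nat \<Rightarrow> nat) \<Rightarrow> 'a set) \<Rightarrow> bool" where
  "usco T F \<longleftrightarrow>
     (\<forall>\<sigma>. F \<sigma> \<noteq> {} \<and> compactin T (F \<sigma>)) \<and>
     (\<forall>\<sigma> V. openin T V \<and> F \<sigma> \<subseteq> V \<longrightarrow> (\<exists>W. open W \<and> \<sigma> \<in> W \<and> (\<Union>\<tau>\<in>W. F \<tau>) \<subseteq> V))"

definition strongly_K_analytic :: "'a topology \<Rightarrow> bool" where
  "strongly_K_analytic T \<longleftrightarrow>
     (\<exists>F. usco T F \<and> (\<Union>\<sigma>. F \<sigma>) = topspace T \<and> (\<forall>L. compactin T L \<longrightarrow> (\<exists>\<sigma>. L \<subseteq> F \<sigma>)))"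

definition SWKA :: "'a::banach itself \<Rightarrow> bool" where
  "SWKA _ \<longleftrightarrow> strongly_K_analytic (weak_topology :: 'a topology)"

definition weakly_Cauchy :: "(nat \<Rightarrow> 'a::real_normed_vector) \<Rightarrow> bool" where
  "weakly_Cauchy s \<longleftrightarrow> (\<forall>f :: 'a \<Rightarrow>\<^sub>L real. Cauchy (\<lambda>n. blinfun_apply f (s n)))"

definition weakly_sequentially_complete :: "'a::banach itself \<Rightarrow> bool" where
  "weakly_sequentially_complete _ \<longleftrightarrow>
     (\<forall>s :: nat \<Rightarrow> 'a. weakly_Cauchy s \<longrightarrow> (\<exists>x. limitin weak_topology s x sequentially))"

text \<open>An inclusion of Banach spaces is given by a linear isometry \<open>j\<close>; its range is automatically
  closed, as the domain is complete.\<close>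

definition isometric_embedding :: "('a::banach \<Rightarrow> 'z::banach) \<Rightarrow> bool" where
  "isometric_embedding j \<longleftrightarrow> linear j \<and> (\<forall>x. norm (j x) = norm x)"

text \<open>As above, \<open>K\<close> may equivalently be taken convex and symmetric (by the Krein theorem).\<close>

definition SWCG_wrt :: "('a::banach \<Rightarrow> 'z::banach) \<Rightarrow> bool" where
  "SWCG_wrt j \<longleftrightarrow>
     (\<exists>K :: 'z set. weakly_compact K \<and>
        (\<forall>\<epsilon>>0. \<forall>L. weakly_compact L \<longrightarrow>
           (\<exists>n::nat. j ` L \<subseteq> {real n *\<^sub>R k + u | k u. k \<in> K \<and> u \<in> cball 0 \<epsilon>})))"


section \<open>The space of absolutely summable sequences\<close>

typedef ell1 = "{x :: nat \<Rightarrow> real. summable (\<lambda>n. \<bar>x n\<bar>)}"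
  morphisms ell1_nth Abs_ell1
  by (rule exI[of _ "\<lambda>_. 0"]) simp

setup_lifting type_definition_ell1

lemma summable_ell1: "summable (\<lambda>n. \<bar>ell1_nth x n\<bar>)"
  using ell1_nth by auto

instantiation ell1 :: real_normed_vector
begin

lift_definition zero_ell1 :: ell1 is "\<lambda>_. 0" by simp

lift_definition uminus_ell1 :: "ell1 \<Rightarrow> ell1" is "\<lambda>x n. - x n" by simp

lift_definition plus_ell1 :: "ell1 \<Rightarrow> ell1 \<Rightarrow> ell1" is "\<lambda>x y n. x n + y n"
proof -
  fix x y :: "nat \<Rightarrow> real"
  assume "summable (\<lambda>n. \<bar>x n\<bar>)" "summable (\<lambda>n. \<bar>y n\<bar>)"
  then have "summable (\<lambda>n. \<bar>x n\<bar> + \<bar>y n\<bar>)"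
    by (rule summable_add)
  then show "summable (\<lambda>n. \<bar>x n + y n\<bar>)"
    by (rule summable_comparison_test') (simp add: abs_triangle_ineq)
qed

lift_definition minus_ell1 :: "ell1 \<Rightarrow> ell1 \<Rightarrow> ell1" is "\<lambda>x y n. x n - y n"
proof -
  fix x y :: "nat \<Rightarrow> real"
  assume "summable (\<lambda>n. \<bar>x n\<bar>)" "summable (\<lambda>n. \<bar>y n\<bar>)"
  then have "summable (\<lambda>n. \<bar>x n\<bar> + \<bar>y n\<bar>)"
    by (rule summable_add)
  then show "summable (\<lambda>n. \<bar>x n - y n\<bar>)"
    by (rule summable_comparison_test') (simp add: abs_triangle_ineq4)
qed

lift_definition scaleR_ell1 :: "real \<Rightarrow> ell1 \<Rightarrow> ell1" is "\<lambda>r x n. r * x n"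
  by (simp add: abs_mult summable_mult)

lift_definition norm_ell1 :: "ell1 \<Rightarrow> real" is "\<lambda>x. \<Sum>n. \<bar>x n\<bar>" .

definition dist_ell1 :: "ell1 \<Rightarrow> ell1 \<Rightarrow> real" where
  "dist_ell1 x y = norm (x - y)"

definition sgn_ell1 :: "ell1 \<Rightarrow> ell1" where
  "sgn_ell1 x = inverse (norm x) *\<^sub>R x"

definition uniformity_ell1 :: "(ell1 \<times> ell1) filter" where
  "uniformity_ell1 = (INF e\<in>{0 <..}. principal {(x, y). dist x y < e})"

definition open_ell1 :: "ell1 set \<Rightarrow> bool" where
  "open_ell1 U = (\<forall>x\<in>U. \<forall>\<^sub>F (x', y) in uniformity. x' = x \<longrightarrow> y \<in> U)"

instance
proof
  fix x y z :: ell1 and a b :: real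
  show "x + y + z = x + (y + z)" "x + y = y + x" "0 + x = x" "- x + x = 0" "x - y = x + - y"
    by (transfer; simp add: algebra_simps)+
  show "a *\<^sub>R (x + y) = a *\<^sub>R x + a *\<^sub>R y" "(a + b) *\<^sub>R x = a *\<^sub>R x + b *\<^sub>R x"
    "a *\<^sub>R b *\<^sub>R x = (a * b) *\<^sub>R x" "1 *\<^sub>R x = x"
    by (transfer; simp add: algebra_simps)+
  show "dist x y = norm (x - y)" by (rule dist_ell1_def)
  show "sgn x = inverse (norm x) *\<^sub>R x" by (rule sgn_ell1_def)
  show "uniformity = (INF e\<in>{0 <..}. principal {(x, y). dist (x::ell1) y < e})"
    by (rule uniformity_ell1_def)
  show "open U = (\<forall>x\<in>U. \<forall>\<^sub>F (x', y) in uniformity. x' = x \<longrightarrow> y \<in> U)" for U :: "ell1 set"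
    by (rule open_ell1_def)
  show "norm x = 0 \<longleftrightarrow> x = 0"
    by transfer (auto simp: suminf_eq_zero_iff)
  show "norm (a *\<^sub>R x) = \<bar>a\<bar> * norm x"
    by transfer (simp add: abs_mult suminf_mult)
  show "norm (x + y) \<le> norm x + norm y"
  proof transfer
    fix x y :: "nat \<Rightarrow> real"
    assume *: "summable (\<lambda>n. \<bar>x n\<bar>)" "summable (\<lambda>n. \<bar>y n\<bar>)"
    then have s: "summable (\<lambda>n. \<bar>x n\<bar> + \<bar>y n\<bar>)"
      by (rule summable_add)
    then have "summable (\<lambda>n. \<bar>x n + y n\<bar>)"
      by (rule summable_comparison_test') (simp add: abs_triangle_ineq)
    then have "(\<Sum>n. \<bar>x n + y n\<bar>) \<le> (\<Sum>n. \<bar>x n\<bar> + \<bar>y n\<bar>)"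
      using s by (intro suminf_le abs_triangle_ineq)
    then show "(\<Sum>n. \<bar>x n + y n\<bar>) \<le> (\<Sum>n. \<bar>x n\<bar>) + (\<Sum>n. \<bar>y n\<bar>)"
      using suminf_add[OF *] by simp
  qed
qed

end

lemma sum_le_norm_ell1: "(\<Sum>n<N. \<bar>ell1_nth x n\<bar>) \<le> norm x"
  unfolding norm_ell1.rep_eq by (rule sum_le_suminf[OF summable_ell1]) auto

lemma abs_nth_le_norm_ell1: "\<bar>ell1_nth x n\<bar> \<le> norm x"
proof -
  have "\<bar>ell1_nth x n\<bar> \<le> (\<Sum>k<Suc n. \<bar>ell1_nth x k\<bar>)"
    by (rule member_le_sum) auto
  then show ?thesis using sum_le_norm_ell1 order_trans by blast
qed

instance ell1 :: banach
proof
  fix X :: "nat \<Rightarrow> ell1"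
  assume X: "Cauchy X"
  have "Cauchy (\<lambda>i. ell1_nth (X i) n)" for n
  proof (rule CauchyI)
    fix e :: real assume "0 < e"
    then obtain M where "\<forall>i\<ge>M. \<forall>j\<ge>M. norm (X i - X j) < e"
      using CauchyD[OF X] by blast
    then show "\<exists>M. \<forall>i\<ge>M. \<forall>j\<ge>M. norm (ell1_nth (X i) n - ell1_nth (X j) n) < e"
      using abs_nth_le_norm_ell1[of "X _ - X _" n]
      by (metis le_less_trans minus_ell1.rep_eq real_norm_def)
  qed
  then have "\<forall>n. \<exists>l. (\<lambda>i. ell1_nth (X i) n) \<longlonglongrightarrow> l"
    by (simp add: Cauchy_convergent_iff convergent_def)
  then obtain l where l: "\<And>n. (\<lambda>i. ell1_nth (X i) n) \<longlonglongrightarrow> l n"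
    by metis
  have bound: "\<exists>M. \<forall>i\<ge>M. \<forall>N. (\<Sum>n<N. \<bar>ell1_nth (X i) n - l n\<bar>) \<le> e" if "0 < e" for e
  proof -
    obtain M where M: "\<forall>i\<ge>M. \<forall>j\<ge>M. norm (X i - X j) < e"
      using CauchyD[OF X \<open>0 < e\<close>] by blast
    have "(\<Sum>n<N. \<bar>ell1_nth (X i) n - l n\<bar>) \<le> e" if "i \<ge> M" for i N
    proof (rule tendsto_upperbound)
      show "(\<lambda>j. \<Sum>n<N. \<bar>ell1_nth (X i) n - ell1_nth (X j) n\<bar>)
              \<longlonglongrightarrow> (\<Sum>n<N. \<bar>ell1_nth (X i) n - l n\<bar>)"
        by (intro tendsto_intros l)
      show "\<forall>\<^sub>F j in sequentially. (\<Sum>n<N. \<bar>ell1_nth (X i) n - ell1_nth (X j) n\<bar>) \<le> e"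
      proof (rule eventually_sequentiallyI)
        fix j assume "M \<le> j"
        then have "norm (X i - X j) < e" using M that by blast
        then show "(\<Sum>n<N. \<bar>ell1_nth (X i) n - ell1_nth (X j) n\<bar>) \<le> e"
          using sum_le_norm_ell1[of "X i - X j" N] by (simp add: minus_ell1.rep_eq)
      qed
    qed simp
    then show ?thesis by blast
  qed
  have summ: "summable (\<lambda>n. \<bar>ell1_nth (X i) n - l n\<bar>)"
    if "\<forall>N. (\<Sum>n<N. \<bar>ell1_nth (X i) n - l n\<bar>) \<le> e" for i e
    using that by (intro summableI_nonneg_bounded[of _ e]) auto
  obtain M where "\<forall>i\<ge>M. \<forall>N. (\<Sum>n<N. \<bar>ell1_nth (X i) n - l n\<bar>) \<le> 1"
    using bound[of 1] by auto
  then have "summable (\<lambda>n. \<bar>ell1_nth (X M) n - l n\<bar>)"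
    using summ by blast
  then have "summable (\<lambda>n. \<bar>ell1_nth (X M) n\<bar> + \<bar>ell1_nth (X M) n - l n\<bar>)"
    by (intro summable_add summable_ell1)
  then have "summable (\<lambda>n. \<bar>l n\<bar>)"
    by (rule summable_comparison_test') auto
  then have nth: "ell1_nth (Abs_ell1 l) = l"
    by (simp add: Abs_ell1_inverse)
  have "X \<longlonglongrightarrow> Abs_ell1 l"
  proof (rule LIMSEQ_I)
    fix e :: real assume "0 < e"
    then obtain M where M: "\<forall>i\<ge>M. \<forall>N. (\<Sum>n<N. \<bar>ell1_nth (X i) n - l n\<bar>) \<le> e / 2"
      using bound[of "e / 2"] by auto
    have "norm (X i - Abs_ell1 l) < e" if "i \<ge> M" for i
    proof -
      have "norm (X i - Abs_ell1 l) \<le> e / 2"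
        unfolding norm_ell1.rep_eq minus_ell1.rep_eq nth
        using M that by (intro suminf_le_const summ[of i "e / 2"]) blast+
      then show ?thesis using \<open>0 < e\<close> by simp
    qed
    then show "\<exists>M. \<forall>i\<ge>M. norm (X i - Abs_ell1 l) < e" by blast
  qed
  then show "convergent X" by (rule convergentI)
qed


section \<open>The \<open>\<ell>\<^sub>2\<close>-sum of countably many copies of a normed space\<close>

typedef (overloaded) 'a l2_sum =
    "{x :: nat \<Rightarrow> 'a::real_normed_vector. summable (\<lambda>m. (norm (x m))\<^sup>2)}"
  morphisms l2_nth Abs_l2_sum
  by (rule exI[of _ "\<lambda>_. 0"]) simp

setup_lifting type_definition_l2_sum

lemma summable_l2_sum: "summable (\<lambda>m. (norm (l2_nth x m))\<^sup>2)"
  using l2_nth by auto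

lemma L2_set_le_sqrt_suminf:
  fixes f :: "nat \<Rightarrow> real"
  assumes "summable (\<lambda>m. (f m)\<^sup>2)"
  shows "L2_set f {..<N} \<le> sqrt (\<Sum>m. (f m)\<^sup>2)"
  unfolding L2_set_def using assms by (intro real_sqrt_le_mono sum_le_suminf) auto

lemma L2_set_bounded_imp:
  fixes f :: "nat \<Rightarrow> real"
  assumes "\<And>N. L2_set f {..<N} \<le> c"
  shows "summable (\<lambda>m. (f m)\<^sup>2)" "sqrt (\<Sum>m. (f m)\<^sup>2) \<le> c"
proof -
  have c: "0 \<le> c" using assms[of 0] by simp
  have le: "(\<Sum>m<N. (f m)\<^sup>2) \<le> c\<^sup>2" for N
    using assms[of N] unfolding L2_set_def by (metis real_sqrt_le_iff real_sqrt_abs abs_of_nonneg c)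
  then show s: "summable (\<lambda>m. (f m)\<^sup>2)"
    by (intro summableI_nonneg_bounded[of _ "c\<^sup>2"]) auto
  have "(\<Sum>m. (f m)\<^sup>2) \<le> c\<^sup>2"
    by (rule suminf_le_const[OF s le])
  then show "sqrt (\<Sum>m. (f m)\<^sup>2) \<le> c"
    using c by (simp add: real_le_lsqrt)
qed

lemma l2_sum_triangle:
  fixes x y :: "nat \<Rightarrow> 'a::real_normed_vector"
  assumes "summable (\<lambda>m. (norm (x m))\<^sup>2)" "summable (\<lambda>m. (norm (y m))\<^sup>2)"
  shows "summable (\<lambda>m. (norm (x m + y m))\<^sup>2)"
    and "sqrt (\<Sum>m. (norm (x m + y m))\<^sup>2)
          \<le> sqrt (\<Sum>m. (norm (x m))\<^sup>2) + sqrt (\<Sum>m. (norm (y m))\<^sup>2)"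
proof -
  have *: "L2_set (\<lambda>m. norm (x m + y m)) {..<N}
             \<le> sqrt (\<Sum>m. (norm (x m))\<^sup>2) + sqrt (\<Sum>m. (norm (y m))\<^sup>2)" for N
  proof -
    have "L2_set (\<lambda>m. norm (x m + y m)) {..<N} \<le> L2_set (\<lambda>m. norm (x m) + norm (y m)) {..<N}"
      by (rule L2_set_mono) (auto simp: norm_triangle_ineq)
    also have "\<dots> \<le> L2_set (\<lambda>m. norm (x m)) {..<N} + L2_set (\<lambda>m. norm (y m)) {..<N}"
      by (rule L2_set_triangle_ineq)
    also have "\<dots> \<le> sqrt (\<Sum>m. (norm (x m))\<^sup>2) + sqrt (\<Sum>m. (norm (y m))\<^sup>2)"
      by (intro add_mono L2_set_le_sqrt_suminf assms)
    finally show ?thesis .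
  qed
  show "summable (\<lambda>m. (norm (x m + y m))\<^sup>2)"
    by (rule L2_set_bounded_imp(1)[OF *])
  show "sqrt (\<Sum>m. (norm (x m + y m))\<^sup>2)
          \<le> sqrt (\<Sum>m. (norm (x m))\<^sup>2) + sqrt (\<Sum>m. (norm (y m))\<^sup>2)"
    by (rule L2_set_bounded_imp(2)[OF *])
qed

instantiation l2_sum :: (real_normed_vector) real_normed_vector
begin

lift_definition zero_l2_sum :: "'a l2_sum" is "\<lambda>_. 0" by simp

lift_definition uminus_l2_sum :: "'a l2_sum \<Rightarrow> 'a l2_sum" is "\<lambda>x m. - x m" by simp

lift_definition plus_l2_sum :: "'a l2_sum \<Rightarrow> 'a l2_sum \<Rightarrow> 'a l2_sum" is "\<lambda>x y m. x m + y m"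
  by (rule l2_sum_triangle(1))

lift_definition minus_l2_sum :: "'a l2_sum \<Rightarrow> 'a l2_sum \<Rightarrow> 'a l2_sum" is "\<lambda>x y m. x m - y m"
  using l2_sum_triangle(1)[of _ "\<lambda>m. - _ m"] by simp

lift_definition scaleR_l2_sum :: "real \<Rightarrow> 'a l2_sum \<Rightarrow> 'a l2_sum" is "\<lambda>r x m. r *\<^sub>R x m"
  by (simp add: power_mult_distrib summable_mult)

lift_definition norm_l2_sum :: "'a l2_sum \<Rightarrow> real" is "\<lambda>x. sqrt (\<Sum>m. (norm (x m))\<^sup>2)" .

definition dist_l2_sum :: "'a l2_sum \<Rightarrow> 'a l2_sum \<Rightarrow> real" where
  "dist_l2_sum x y = norm (x - y)"

definition sgn_l2_sum :: "'a l2_sum \<Rightarrow> 'a l2_sum" where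
  "sgn_l2_sum x = inverse (norm x) *\<^sub>R x"

definition uniformity_l2_sum :: "('a l2_sum \<times> 'a l2_sum) filter" where
  "uniformity_l2_sum = (INF e\<in>{0 <..}. principal {(x, y). dist x y < e})"

definition open_l2_sum :: "'a l2_sum set \<Rightarrow> bool" where
  "open_l2_sum U = (\<forall>x\<in>U. \<forall>\<^sub>F (x', y) in uniformity. x' = x \<longrightarrow> y \<in> U)"

instance
proof
  fix x y z :: "'a l2_sum" and a b :: real
  show "x + y + z = x + (y + z)" "x + y = y + x" "0 + x = x" "- x + x = 0" "x - y = x + - y"
    by (transfer; simp add: algebra_simps)+
  show "a *\<^sub>R (x + y) = a *\<^sub>R x + a *\<^sub>R y" "(a + b) *\<^sub>R x = a *\<^sub>R x + b *\<^sub>R x"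
    "a *\<^sub>R b *\<^sub>R x = (a * b) *\<^sub>R x" "1 *\<^sub>R x = x"
    by (transfer; simp add: algebra_simps)+
  show "dist x y = norm (x - y)" by (rule dist_l2_sum_def)
  show "sgn x = inverse (norm x) *\<^sub>R x" by (rule sgn_l2_sum_def)
  show "uniformity = (INF e\<in>{0 <..}. principal {(x, y). dist (x::'a l2_sum) y < e})"
    by (rule uniformity_l2_sum_def)
  show "open U = (\<forall>x\<in>U. \<forall>\<^sub>F (x', y) in uniformity. x' = x \<longrightarrow> y \<in> U)" for U :: "'a l2_sum set"
    by (rule open_l2_sum_def)
  show "norm x = 0 \<longleftrightarrow> x = 0"
    by transfer (auto simp: suminf_eq_zero_iff)
  show "norm (a *\<^sub>R x) = \<bar>a\<bar> * norm x"
    by transfer (simp add: power_mult_distrib suminf_mult real_sqrt_mult)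
  show "norm (x + y) \<le> norm x + norm y"
    by transfer (rule l2_sum_triangle(2))
qed

end

lemma L2_set_le_norm_l2_sum: "L2_set (\<lambda>m. norm (l2_nth x m)) {..<N} \<le> norm x"
  unfolding norm_l2_sum.rep_eq by (rule L2_set_le_sqrt_suminf[OF summable_l2_sum])

lemma norm_nth_le_norm_l2_sum: "norm (l2_nth x m) \<le> norm x"
  using member_le_L2_set[of "{..<Suc m}" m "\<lambda>m. norm (l2_nth x m)"]
    L2_set_le_norm_l2_sum[of x "Suc m"] by simp

instance l2_sum :: (banach) banach
proof
  fix X :: "nat \<Rightarrow> 'a l2_sum"
  assume X: "Cauchy X"
  have "Cauchy (\<lambda>i. l2_nth (X i) m)" for m
  proof (rule CauchyI)
    fix e :: real assume "0 < e"
    then obtain M where "\<forall>i\<ge>M. \<forall>j\<ge>M. norm (X i - X j) < e"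
      using CauchyD[OF X] by blast
    then show "\<exists>M. \<forall>i\<ge>M. \<forall>j\<ge>M. norm (l2_nth (X i) m - l2_nth (X j) m) < e"
      using norm_nth_le_norm_l2_sum[of "X _ - X _" m]
      by (metis le_less_trans minus_l2_sum.rep_eq)
  qed
  then have "\<forall>m. \<exists>l. (\<lambda>i. l2_nth (X i) m) \<longlonglongrightarrow> l"
    by (simp add: Cauchy_convergent_iff convergent_def)
  then obtain l where l: "\<And>m. (\<lambda>i. l2_nth (X i) m) \<longlonglongrightarrow> l m"
    by metis
  have bound: "\<exists>M. \<forall>i\<ge>M. \<forall>N. L2_set (\<lambda>m. norm (l2_nth (X i) m - l m)) {..<N} \<le> e"
    if "0 < e" for e
  proof -
    obtain M where M: "\<forall>i\<ge>M. \<forall>j\<ge>M. norm (X i - X j) < e"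
      using CauchyD[OF X \<open>0 < e\<close>] by blast
    have "L2_set (\<lambda>m. norm (l2_nth (X i) m - l m)) {..<N} \<le> e" if "i \<ge> M" for i N
    proof (rule tendsto_upperbound)
      show "(\<lambda>j. L2_set (\<lambda>m. norm (l2_nth (X i) m - l2_nth (X j) m)) {..<N})
              \<longlonglongrightarrow> L2_set (\<lambda>m. norm (l2_nth (X i) m - l m)) {..<N}"
        unfolding L2_set_def by (intro tendsto_intros l)
      show "\<forall>\<^sub>F j in sequentially.
              L2_set (\<lambda>m. norm (l2_nth (X i) m - l2_nth (X j) m)) {..<N} \<le> e"
      proof (rule eventually_sequentiallyI)
        fix j assume "M \<le> j"
        then have "norm (X i - X j) < e" using M that by blast
        then show "L2_set (\<lambda>m. norm (l2_nth (X i) m - l2_nth (X j) m)) {..<N} \<le> e"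
          using L2_set_le_norm_l2_sum[of "X i - X j" N] by (simp add: minus_l2_sum.rep_eq)
      qed
    qed simp
    then show ?thesis by blast
  qed
  obtain M where "\<forall>i\<ge>M. \<forall>N. L2_set (\<lambda>m. norm (l2_nth (X i) m - l m)) {..<N} \<le> 1"
    using bound[of 1] by auto
  then have "summable (\<lambda>m. (norm (l2_nth (X M) m - l m))\<^sup>2)"
    by (intro L2_set_bounded_imp(1)[of _ 1]) simp
  then have "summable (\<lambda>m. (norm (l m - l2_nth (X M) m))\<^sup>2)"
    by (simp add: norm_minus_commute)
  then have "summable (\<lambda>m. (norm (l m - l2_nth (X M) m + l2_nth (X M) m))\<^sup>2)"
    by (rule l2_sum_triangle(1)[OF _ summable_l2_sum])
  then have nth: "l2_nth (Abs_l2_sum l) = l"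
    by (simp add: Abs_l2_sum_inverse)
  have "X \<longlonglongrightarrow> Abs_l2_sum l"
  proof (rule LIMSEQ_I)
    fix e :: real assume "0 < e"
    then obtain M where
      M: "\<forall>i\<ge>M. \<forall>N. L2_set (\<lambda>m. norm (l2_nth (X i) m - l m)) {..<N} \<le> e / 2"
      using bound[of "e / 2"] by auto
    have "norm (X i - Abs_l2_sum l) < e" if "i \<ge> M" for i
    proof -
      have "norm (X i - Abs_l2_sum l) \<le> e / 2"
        unfolding norm_l2_sum.rep_eq minus_l2_sum.rep_eq nth
        using M that by (intro L2_set_bounded_imp(2)) blast
      then show ?thesis using \<open>0 < e\<close> by simp
    qed
    then show "\<exists>M. \<forall>i\<ge>M. norm (X i - Abs_l2_sum l) < e" by blast
  qed
  then show "convergent X" by (rule convergentI)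
qed

text \<open>The labels \<open>m\<close> in \<open>\<ell>\<^sub>1(\<nat> \<times> {m})\<close> only make the index sets disjoint: the \<open>m\<close>-th summand is
  the \<open>m\<close>-th coordinate, with indices starting at \<open>0\<close>.\<close>

type_synonym l2_sum_of_ell1 = "ell1 l2_sum"

end

theory Submission
  imports Defs
begin

text \<open>The unit vectors are \<open>e\<^sub>m\<^sub>,\<^sub>i\<close> with column \<open>m\<close>. For every \<open>\<phi>\<close> the set of all
  \<open>e\<^sub>m\<^sub>,\<^sub>i\<close> with \<open>i \<le> \<phi> m\<close> is relatively weakly compact, because different columns are combined in
  the \<open>\<ell>\<^sub>2\<close> norm. A \<open>1/2\<close>-weakly relatively compact set contains only finitely many unit vectors of
  each column, since weak-star cluster points of the \<open>\<ell>\<^sub>1\<close> basis have distance \<open>1\<close> from the space.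
  Given countably many such sets, let \<open>\<phi>\<close> leave the \<open>m\<close>-th one in column \<open>m\<close>: no set of the
  family then absorbs the resulting weakly compact set. The same diagonal argument refutes SWCG, with
  Mazur's theorem replacing weak-star cluster points.

  A bounded set is relatively weakly compact iff in each column its \<open>\<ell>\<^sub>1\<close> tails are uniformly small:
  functionals decay along the columns, and by Schur's gliding hump weak compactness in one column is
  norm compactness. Bounds on the norm and on the tails are encoded by \<open>\<sigma> \<in> \<nat>\<^sup>\<nat>\<close>, which yields the
  usco map. A gliding hump also gives weak sequential completeness.\<close>

section \<open>The Hahn-Banach theorem\<close>

text \<open>Homogeneity is asked only as an inequality for positive \<open>c\<close>, the form in
  which an infimum inherits it; applied to \<open>inverse c\<close> as well, it yields
  equality.\<close>

definition sublinear :: "('a::real_vector \<Rightarrow> real) \<Rightarrow> bool" where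
  "sublinear p \<longleftrightarrow> (\<forall>x y. p (x + y) \<le> p x + p y) \<and> (\<forall>c>0. \<forall>x. p (c *\<^sub>R x) \<le> c * p x) \<and> p 0 = 0"

lemma sublinear_scale:
  assumes "sublinear p" "c \<ge> 0"
  shows "p (c *\<^sub>R x) = c * p x"
proof (cases "c = 0")
  case False
  with assms have c: "c > 0" by simp
  have "p (inverse c *\<^sub>R (c *\<^sub>R x)) \<le> inverse c * p (c *\<^sub>R x)"
    using assms(1) positive_imp_inverse_positive[OF c] unfolding sublinear_def by blast
  then have "c * p x \<le> p (c *\<^sub>R x)" using c by (simp add: field_simps)
  moreover have "p (c *\<^sub>R x) \<le> c * p x" using assms(1) c unfolding sublinear_def by blast
  ultimately show ?thesis by simp
qed (use assms in \<open>auto simp: sublinear_def\<close>)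

lemma sublinear_add: "sublinear p \<Longrightarrow> p (x + y) \<le> p x + p y"
  by (simp add: sublinear_def)

lemma sublinear_minus: "sublinear p \<Longrightarrow> - p (- x) \<le> p x"
  using sublinear_add[of p x "- x"] by (simp add: sublinear_def)

text \<open>For fixed \<open>j\<close> the infimum over \<open>i\<close> is taken first, then the
  one over \<open>j\<close>. As the index \<open>k\<close> may depend on all other data, this covers
  both the lowering of a functional along a convex set and the infimum of a chain in Zorn's
  lemma.\<close>

lemma sublinear_INF:
  assumes "\<And>x. bdd_below ((\<lambda>i. h i x) ` I)"
    and add: "\<And>i j x y. i \<in> I \<Longrightarrow> j \<in> I \<Longrightarrow> \<exists>k\<in>I. h k (x + y) \<le> h i x + h j y"
    and scale: "\<And>i c x. i \<in> I \<Longrightarrow> c > 0 \<Longrightarrow> \<exists>k\<in>I. h k (c *\<^sub>R x) \<le> c * h i x"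
    and zero: "\<And>i. i \<in> I \<Longrightarrow> h i 0 \<ge> 0" "\<exists>i\<in>I. h i 0 \<le> 0"
  shows "sublinear (\<lambda>x. INF i\<in>I. h i x)"
proof -
  have ne: "I \<noteq> {}" using zero by auto
  have low: "(INF i\<in>I. h i x) \<le> h k x" if "k \<in> I" for k x
    using assms(1) that by (rule cINF_lower)
  have "(INF i\<in>I. h i (x + y)) \<le> (INF i\<in>I. h i x) + (INF i\<in>I. h i y)" for x y
  proof -
    have *: "(INF i\<in>I. h i (x + y)) \<le> h i x + h j y" if "i \<in> I" "j \<in> I" for i j
      using add[OF that, of x y] low order_trans by blast
    have "(INF i\<in>I. h i (x + y)) - h j y \<le> (INF i\<in>I. h i x)" if "j \<in> I" for j
      using *[OF _ that] by (intro cINF_greatest[OF ne]) (simp add: diff_le_eq)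
    then have "(INF i\<in>I. h i (x + y)) - (INF i\<in>I. h i x) \<le> (INF i\<in>I. h i y)"
      by (intro cINF_greatest[OF ne]) (simp add: algebra_simps)
    then show ?thesis by simp
  qed
  moreover have "(INF i\<in>I. h i (c *\<^sub>R x)) \<le> c * (INF i\<in>I. h i x)" if "c > 0" for c x
  proof -
    have "(INF i\<in>I. h i (c *\<^sub>R x)) \<le> c * h i x" if "i \<in> I" for i
      using scale[OF that \<open>c > 0\<close>, of x] low order_trans by blast
    then have "(INF i\<in>I. h i (c *\<^sub>R x)) / c \<le> h i x" if "i \<in> I" for i
      using that \<open>c > 0\<close> by (simp add: divide_le_eq mult.commute)
    then have "(INF i\<in>I. h i (c *\<^sub>R x)) / c \<le> (INF i\<in>I. h i x)"
      using ne by (intro cINF_greatest) auto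
    then show ?thesis using that by (simp add: field_simps)
  qed
  moreover have "(INF i\<in>I. h i 0) = 0"
    using zero low[of _ 0] by (intro order_antisym cINF_greatest[OF ne]) (auto intro: order_trans)
  ultimately show ?thesis unfolding sublinear_def by blast
qed

text \<open>Take for \<open>q x\<close> the infimum of \<open>p (x + t *\<^sub>R d) - t * a\<close>
  over \<open>t \<ge> 0\<close> and \<open>d \<in> D\<close>. Convexity makes the multiples
  \<open>t *\<^sub>R d\<close> closed under addition, which gives subadditivity, and the bound
  \<open>a\<close> keeps the infimum above \<open>- p (- x)\<close>.\<close>

lemma sublinear_lower:
  assumes p: "sublinear p" and D: "convex D" "D \<noteq> {}" and a: "\<And>d. d \<in> D \<Longrightarrow> a \<le> p d"
  shows "\<exists>q. sublinear q \<and> (\<forall>x. q x \<le> p x) \<and> (\<forall>d\<in>D. q (- d) \<le> - a)"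
proof -
  define h where "h = (\<lambda>(t::real, d) x. p (x + t *\<^sub>R d) - t * a)"
  define I where "I = {0::real..} \<times> D"
  define q where "q x = (INF i\<in>I. h i x)" for x
  have low: "- p (- x) \<le> h i x" if "i \<in> I" for i x
  proof -
    obtain t d where i: "i = (t, d)" "t \<ge> 0" "d \<in> D" using \<open>i \<in> I\<close> by (auto simp: I_def)
    have "t * a \<le> p (t *\<^sub>R d)" using a i by (simp add: sublinear_scale[OF p] mult_left_mono)
    also have "\<dots> \<le> p (x + t *\<^sub>R d) + p (- x)"
      using sublinear_add[OF p, of "x + t *\<^sub>R d" "- x"] by simp
    finally show ?thesis by (simp add: h_def i)
  qed
  have bdd: "bdd_below ((\<lambda>i. h i x) ` I)" for x
    using low by (auto intro!: bdd_belowI2)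
  obtain d0 where d0: "d0 \<in> D" using D by auto
  have "sublinear q" unfolding q_def
  proof (rule sublinear_INF[OF bdd])
    fix i j x y assume "i \<in> I" "j \<in> I"
    then obtain s d t e where ij: "i = (s, d)" "j = (t, e)" and st: "s \<ge> 0" "t \<ge> 0" "d \<in> D" "e \<in> D"
      by (auto simp: I_def)
    \<comment> \<open>The point \<open>f\<close> is the weighted mean of \<open>d\<close> and
      \<open>e\<close>; when both weights vanish, any point of \<open>D\<close> serves.\<close>
    obtain f where f: "f \<in> D" "s *\<^sub>R d + t *\<^sub>R e = (s + t) *\<^sub>R f"
    proof (cases "s + t = 0")
      case False
      have "(s / (s + t)) *\<^sub>R d + (t / (s + t)) *\<^sub>R e \<in> D"
        using D st False by (intro convexD) (auto simp: add_divide_distrib[symmetric])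
      then show ?thesis using that False by (auto simp: scaleR_add_right)
    next
      case True
      then have "s = 0" "t = 0" using st by auto
      then show ?thesis using that st by auto
    qed
    have "p ((x + y) + (s + t) *\<^sub>R f) \<le> p (x + s *\<^sub>R d) + p (y + t *\<^sub>R e)"
      using sublinear_add[OF p, of "x + s *\<^sub>R d" "y + t *\<^sub>R e"] by (simp add: f(2)[symmetric] add_ac)
    then show "\<exists>k\<in>I. h k (x + y) \<le> h i x + h j y"
      using f st by (intro bexI[of _ "(s + t, f)"]) (auto simp: I_def h_def ij algebra_simps)
  next
    fix i c x assume "i \<in> I" and c: "(c::real) > 0"
    then obtain t d where i: "i = (t, d)" "t \<ge> 0" "d \<in> D" by (auto simp: I_def)
    have "h (c * t, d) (c *\<^sub>R x) = c * h i x"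
      using c sublinear_scale[OF p, of c "x + t *\<^sub>R d"] by (simp add: h_def i algebra_simps)
    then show "\<exists>k\<in>I. h k (c *\<^sub>R x) \<le> c * h i x"
      using i c by (intro bexI[of _ "(c * t, d)"]) (auto simp: I_def)
  next
    fix i assume "i \<in> I" then show "0 \<le> h i 0" using low[of i 0] p by (simp add: sublinear_def)
  next
    show "\<exists>i\<in>I. h i 0 \<le> 0"
      using d0 p by (intro bexI[of _ "(0, d0)"]) (auto simp: I_def h_def sublinear_def)
  qed
  moreover have "q x \<le> p x" for x
    unfolding q_def using d0 by (intro cINF_lower2[OF bdd, of "(0, d0)"]) (auto simp: I_def h_def)
  moreover have "q (- d) \<le> - a" if "d \<in> D" for d
    unfolding q_def using that p
    by (intro cINF_lower2[OF bdd, of "(1, d)"]) (auto simp: I_def h_def sublinear_def)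
  ultimately show ?thesis by blast
qed

text \<open>Zorn's lemma: the pointwise infimum of a chain bounds it from below, and it is finite
  because every sublinear functional below \<open>p\<close> stays above
  \<open>- p (- x)\<close>.\<close>

lemma minimal_sublinear:
  assumes p: "sublinear p"
  shows "\<exists>m. sublinear m \<and> (\<forall>x. m x \<le> p x) \<and> (\<forall>q. sublinear q \<longrightarrow> (\<forall>x. q x \<le> m x) \<longrightarrow> q = m)"
proof -
  define A where "A = {q. sublinear q \<and> (\<forall>x. q x \<le> p x)}"
  \<comment> \<open>The order is reversed, so that a maximal element is a minimal
    functional.\<close>
  define P where "P = (\<lambda>f g :: 'a \<Rightarrow> real. \<forall>x. g x \<le> f x)"
  have "\<exists>m\<in>A. \<forall>a\<in>A. P m a \<longrightarrow> a = m"
  proof (rule predicate_Zorn)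
    show "partial_order_on A (relation_of P A)"
      by (rule partial_order_on_relation_ofI) (auto simp: P_def fun_eq_iff intro: order_trans order_antisym)
  next
    fix C assume C: "C \<in> Chains (relation_of P A)"
    show "\<exists>u\<in>A. \<forall>a\<in>C. P a u"
    proof (cases "C = {}")
      case True
      then show ?thesis using p by (auto simp: A_def)
    next
      case False
      have sub: "sublinear f" "f x \<le> p x" if "f \<in> C" for f x
        using that Chains_relation_of[OF C] by (auto simp: A_def)
      have tot: "P f g \<or> P g f" if "f \<in> C" "g \<in> C" for f g
        using C that by (auto simp: Chains_def relation_of_def)
      define u where "u x = (INF f\<in>C. f x)" for x
      have bdd: "bdd_below ((\<lambda>f. f x) ` C)" for x
      proof (rule bdd_belowI2)
        fix f assume "f \<in> C"
        then show "- p (- x) \<le> f x" using sublinear_minus[OF sub(1), of f x] sub(2)[of f "- x"] by force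
      qed
      have "sublinear u" unfolding u_def
      proof (rule sublinear_INF[OF bdd])
        fix f g x y assume fg: "f \<in> C" "g \<in> C"
        \<comment> \<open>The smaller of \<open>f\<close> and \<open>g\<close> serves as
          \<open>k\<close>.\<close>
        show "\<exists>k\<in>C. k (x + y) \<le> f x + g y"
          using tot[OF fg] sublinear_add[OF sub(1)[OF fg(1)], of x y]
            sublinear_add[OF sub(1)[OF fg(2)], of x y] fg unfolding P_def
          by (smt (verit))
      next
        fix f c x assume "f \<in> C" "(c::real) > 0"
        then show "\<exists>k\<in>C. k (c *\<^sub>R x) \<le> c * f x" using sub(1) by (auto simp: sublinear_def)
      next
        have "f 0 = 0" if "f \<in> C" for f using sub(1)[OF that] by (simp add: sublinear_def)
        then show "\<And>f. f \<in> C \<Longrightarrow> 0 \<le> f 0" "\<exists>f\<in>C. f 0 \<le> 0" using False by fastforce+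
      qed
      moreover have le: "u x \<le> f x" if "f \<in> C" for f x
        unfolding u_def using bdd that by (rule cINF_lower)
      moreover have "u x \<le> p x" for x
        using False le sub(2) order_trans by blast
      ultimately show ?thesis by (auto simp: A_def P_def)
    qed
  qed
  then obtain m where m: "m \<in> A" "\<And>a. a \<in> A \<Longrightarrow> P m a \<Longrightarrow> a = m" by blast
  then have "q = m" if "sublinear q" "\<forall>x. q x \<le> m x" for q
    using that by (auto simp: A_def P_def intro: order_trans)
  with m(1) show ?thesis by (auto simp: A_def)
qed

text \<open>The functional is a minimal sublinear functional below a suitable one: lowering it at a single
  vector \<open>y\<close> changes nothing, so it is odd and hence linear.\<close>

theorem hahn_banach_convex:
  fixes p :: "'a::real_vector \<Rightarrow> real"
  assumes p: "sublinear p" and D: "convex D" "D \<noteq> {}" and a: "\<And>d. d \<in> D \<Longrightarrow> a \<le> p d"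
  shows "\<exists>f. linear f \<and> (\<forall>x. f x \<le> p x) \<and> (\<forall>d\<in>D. a \<le> f d)"
proof -
  obtain q where q: "sublinear q" "\<And>x. q x \<le> p x" "\<And>d. d \<in> D \<Longrightarrow> q (- d) \<le> - a"
    using sublinear_lower[OF assms] by blast
  obtain m where m: "sublinear m" "\<And>x. m x \<le> q x"
    and min: "\<And>r. sublinear r \<Longrightarrow> (\<forall>x. r x \<le> m x) \<Longrightarrow> r = m"
    using minimal_sublinear[OF q(1)] by blast
  have minus: "m (- y) = - m y" for y
  proof -
    obtain r where "sublinear r" "\<forall>x. r x \<le> m x" "r (- y) \<le> - m y"
      using sublinear_lower[OF m(1), of "{y}" "m y"] by auto
    with min have "m (- y) \<le> - m y" by blast
    then show ?thesis using sublinear_minus[OF m(1), of y] by simp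
  qed
  have add: "m (x + y) = m x + m y" for x y
  proof -
    have "- m (x + y) \<le> - m x - m y"
      using sublinear_add[OF m(1), of "- x" "- y"] minus[of "x + y"] minus[of x] minus[of y] by simp
    with sublinear_add[OF m(1), of x y] show ?thesis by simp
  qed
  have "m (c *\<^sub>R x) = c * m x" for c x
    using sublinear_scale[OF m(1), of c x] sublinear_scale[OF m(1), of "- c" x] minus[of "c *\<^sub>R x"]
    by (cases "c \<ge> 0") auto
  with add have "linear m" by (simp add: linear_iff)
  moreover have "m x \<le> p x" for x using m q order_trans by blast
  moreover have "a \<le> m d" if "d \<in> D" for d
    using m(2)[of "- d"] q(3)[OF that] minus[of d] by simp
  ultimately show ?thesis by blast
qed

text \<open>A functional of norm at most \<open>1\<close> separates \<open>D\<close> from the open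
  ball of radius \<open>a\<close> about the origin. Singletons give norming functionals, translated
  convex hulls give Mazur's theorem.\<close>

lemma hahn_banach_norm:
  fixes D :: "'a::real_normed_vector set"
  assumes D: "convex D" "D \<noteq> {}" and a: "\<And>d. d \<in> D \<Longrightarrow> a \<le> norm d"
  shows "\<exists>f :: 'a \<Rightarrow>\<^sub>L real. norm f \<le> 1 \<and> (\<forall>d\<in>D. a \<le> blinfun_apply f d)"
proof -
  have "sublinear (norm :: 'a \<Rightarrow> real)" by (simp add: sublinear_def norm_triangle_ineq)
  from hahn_banach_convex[OF this D a] obtain f
    where f: "linear f" "\<And>x. f x \<le> norm x" "\<And>d. d \<in> D \<Longrightarrow> a \<le> f d" by blast
  have abs: "\<bar>f x\<bar> \<le> norm x" for x
    using f(2)[of x] f(2)[of "- x"] linear_neg[OF f(1), of x] by (simp add: abs_le_iff)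
  then have "bounded_linear f"
    using f(1) by (auto simp: linear_conv_bounded_linear[symmetric] bounded_linear_def bounded_linear_axioms_def intro: exI[of _ 1])
  then have "blinfun_apply (Blinfun f) = f" by (rule bounded_linear_Blinfun_apply)
  moreover from this have "norm (Blinfun f) \<le> 1" using abs by (intro norm_blinfun_bound) auto
  ultimately show ?thesis using f(3) by metis
qed

lemma norm_attaining_functional:
  fixes x :: "'a::real_normed_vector"
  shows "\<exists>f :: 'a \<Rightarrow>\<^sub>L real. norm f \<le> 1 \<and> blinfun_apply f x = norm x"
proof -
  obtain f :: "'a \<Rightarrow>\<^sub>L real" where f: "norm f \<le> 1" "norm x \<le> blinfun_apply f x"
    using hahn_banach_norm[of "{x}" "norm x"] by auto
  moreover have "blinfun_apply f x \<le> norm x"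
    using norm_blinfun[of f x] f(1) by (smt (verit) mult_left_le_one_le norm_ge_zero real_norm_def)
  ultimately show ?thesis by (auto intro: exI[of _ f])
qed

section \<open>Weak topologies\<close>

lemma topspace_weak_topology [simp]: "topspace weak_topology = UNIV"
  by (simp add: weak_topology_def topspace_pullback_topology)

lemma continuous_map_weak_functional:
  "continuous_map weak_topology euclidean (blinfun_apply (f :: 'a::real_normed_vector \<Rightarrow>\<^sub>L real))"
proof -
  have "continuous_map weak_topology euclidean
          ((\<lambda>h. h f) \<circ> (\<lambda>x (g :: 'a \<Rightarrow>\<^sub>L real). blinfun_apply g x))"
    unfolding weak_topology_def
    by (rule continuous_map_pullback) (use continuous_on_product_coordinates in fastforce)
  then show ?thesis by (simp add: comp_def)
qed

lemma continuous_map_into_weak: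
  assumes "\<And>f :: 'a::real_normed_vector \<Rightarrow>\<^sub>L real. continuous_map T euclidean (\<lambda>y. blinfun_apply f (g y))"
  shows "continuous_map T weak_topology g"
proof -
  have "continuous_map T euclidean (\<lambda>y (f :: 'a \<Rightarrow>\<^sub>L real). blinfun_apply f (g y))"
    using assms by (simp add: euclidean_product_topology[symmetric] continuous_map_componentwise_UNIV)
  then show ?thesis
    unfolding weak_topology_def by (intro continuous_map_pullback') (auto simp: comp_def)
qed

lemma limitin_weak_topology:
  assumes "\<And>f :: 'a::real_normed_vector \<Rightarrow>\<^sub>L real. ((\<lambda>n. blinfun_apply f (s n)) \<longlongrightarrow> blinfun_apply f x) F"
  shows "limitin weak_topology s x F"
  unfolding limitin_def
proof (intro conjI allI impI)
  fix V assume "openin weak_topology V \<and> x \<in> V"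
  then obtain U where U: "open U" "V = (\<lambda>x (f :: 'a \<Rightarrow>\<^sub>L real). blinfun_apply f x) -` U" and x: "x \<in> V"
    by (auto simp: weak_topology_def openin_pullback_topology)
  have "limitin euclidean (\<lambda>n (f :: 'a \<Rightarrow>\<^sub>L real). blinfun_apply f (s n)) (\<lambda>f. blinfun_apply f x) F"
    using assms by (simp only: euclidean_product_topology[symmetric] limitin_componentwise) auto
  then show "\<forall>\<^sub>F n in F. s n \<in> V"
    using U x by (auto simp: limitin_def)
qed simp

lemma weakly_compact_bounded_functional:
  fixes f :: "'a::real_normed_vector \<Rightarrow>\<^sub>L real"
  assumes "weakly_compact L"
  shows "bounded (blinfun_apply f ` L)"
  using image_compactin[OF assms continuous_map_weak_functional, of f] by (simp add: compact_imp_bounded)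

text \<open>Mazur's theorem: if the hull kept distance \<open>e\<close> from \<open>z\<close>, some
  functional would be at least \<open>e\<close> on all differences from \<open>z\<close>, and the
  half-space below that level would be a weak neighbourhood of \<open>z\<close> missing
  \<open>S\<close>.\<close>

lemma mazur_approx:
  assumes z: "z \<in> weak_topology closure_of S" and e: "e > 0"
  shows "\<exists>c \<in> convex hull S. norm (c - z) < e"
proof (rule ccontr)
  assume *: "\<not> ?thesis"
  define D where "D = (\<lambda>c. c - z) ` (convex hull S)"
  have "z \<in> topspace weak_topology" "openin weak_topology UNIV"
    using openin_topspace[of weak_topology] by auto
  then have "S \<noteq> {}" using z by (auto simp: in_closure_of)
  then have D: "convex D" "D \<noteq> {}"
    by (auto simp: D_def convex_hull_eq_empty intro!: convex_translation_subtract)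
  obtain f :: "'a \<Rightarrow>\<^sub>L real" where f: "\<And>d. d \<in> D \<Longrightarrow> e \<le> blinfun_apply f d"
    using hahn_banach_norm[OF D, of e] * by (fastforce simp: D_def not_less)
  define V where "V = {w. blinfun_apply f w < blinfun_apply f z + e}"
  have "openin weak_topology V"
    using openin_continuous_map_preimage[OF continuous_map_weak_functional,
        of "{..<blinfun_apply f z + e}" f] by (simp add: V_def)
  moreover have "z \<in> V" using e by (simp add: V_def)
  ultimately obtain y where "y \<in> S" "y \<in> V"
    using z by (auto simp: in_closure_of)
  moreover from this have "y - z \<in> D" by (auto simp: D_def intro: hull_inc)
  ultimately show False using f[of "y - z"] by (simp add: V_def blinfun.diff_right)
qed

text \<open>The uniform boundedness principle: the dual is complete, so by Baire one of the closed
  sets \<open>T n\<close> contains a ball, on which the values at the points of \<open>S\<close> are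
  uniformly bounded.\<close>

lemma weakly_bounded_imp_bounded:
  fixes S :: "'a::real_normed_vector set"
  assumes "\<And>f :: 'a \<Rightarrow>\<^sub>L real. bounded (blinfun_apply f ` S)"
  shows "bounded S"
proof -
  define T where "T n = {f :: 'a \<Rightarrow>\<^sub>L real. \<forall>x\<in>S. \<bar>blinfun_apply f x\<bar> \<le> real n}" for n
  have closed: "closed (T n)" for n
  proof -
    have "T n = (\<Inter>x\<in>S. {f. \<bar>blinfun_apply f x\<bar> \<le> real n})" by (auto simp: T_def)
    also have "closed \<dots>"
      by (intro closed_INT ballI closed_Collect_le continuous_intros)
    finally show ?thesis .
  qed
  have UN: "(\<Union>n. T n) = UNIV"
  proof safe
    fix f :: "'a \<Rightarrow>\<^sub>L real"
    obtain B where "\<And>x. x \<in> S \<Longrightarrow> \<bar>blinfun_apply f x\<bar> \<le> B"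
      using assms[of f] by (auto simp: bounded_iff)
    moreover obtain n where "B \<le> real n" using real_arch_simple by blast
    ultimately have "f \<in> T n" by (auto simp: T_def intro: order_trans)
    then show "f \<in> (\<Union>n. T n)" by blast
  qed simp
  have "\<exists>n. interior (T n) \<noteq> {}"
  proof (rule ccontr)
    assume *: "\<not> ?thesis"
    have "euclidean interior_of \<Union>(range T) = {}"
      by (rule Baire_category_alt) (use * closed in \<open>auto simp: completely_metrizable_space_euclidean\<close>)
    then show False using UN by simp
  qed
  then obtain n f r where r: "r > 0" "ball f r \<subseteq> T n"
    by (meson ex_in_conv mem_interior)
  \<comment> \<open>A norming functional \<open>g\<close> of \<open>x\<close>, scaled by
    \<open>r / 2\<close>, can be added to the centre \<open>f\<close> without leaving the ball;
    comparing the two values bounds \<open>norm x\<close>.\<close>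
  have "norm x \<le> 4 * real n / r" if "x \<in> S" for x
  proof -
    obtain g :: "'a \<Rightarrow>\<^sub>L real" where g: "norm g \<le> 1" "blinfun_apply g x = norm x"
      using norm_attaining_functional by blast
    have "norm ((r / 2) *\<^sub>R g) < r" using g r mult_left_mono[of "norm g" 1 "r / 2"] by simp
    then have "f + (r / 2) *\<^sub>R g \<in> T n" using r by (auto simp: dist_norm)
    moreover have "f \<in> T n" using r by auto
    ultimately have "\<bar>blinfun_apply f x + (r / 2) * norm x\<bar> \<le> real n" "\<bar>blinfun_apply f x\<bar> \<le> real n"
      using that g by (auto simp: T_def blinfun.add_left blinfun.scaleR_left)
    then have "(r / 2) * norm x \<le> 2 * real n" by linarith
    then show ?thesis using r by (simp add: field_simps)
  qed
  then show ?thesis by (auto simp: bounded_iff)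
qed

lemma weakly_compact_imp_bounded: "weakly_compact L \<Longrightarrow> bounded L"
  using weakly_bounded_imp_bounded weakly_compact_bounded_functional by blast

text \<open>Otherwise the complements of the closures of the tails cover \<open>K\<close>. In a
  finite subcover, the term with the largest index involved lies in all the corresponding tails,
  hence in none of the covering sets.\<close>

lemma compactin_cluster_point:
  fixes x :: "nat \<Rightarrow> 'a"
  assumes K: "compactin T K" and x: "\<And>n. x n \<in> K"
  shows "\<exists>z\<in>K. \<forall>l. z \<in> T closure_of (x ` {l..})"
proof (rule ccontr)
  assume *: "\<not> ?thesis"
  define U where "U l = topspace T - T closure_of (x ` {l..})" for l
  have KT: "K \<subseteq> topspace T" using K by (rule compactin_subset_topspace)
  have "\<exists>\<F>. finite \<F> \<and> \<F> \<subseteq> range U \<and> K \<subseteq> \<Union>\<F>"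
    using K * KT by (intro compactinD[OF K]) (auto simp: U_def)
  then obtain I where I: "finite I" "K \<subseteq> (\<Union>l\<in>I. U l)"
    by (metis finite_subset_image)
  define l where "l = Max (insert 0 I)"
  obtain i where i: "i \<in> I" "x l \<in> U i" using I x by blast
  then have "i \<le> l" using I by (simp add: l_def)
  then have "x l \<in> T closure_of (x ` {i..})"
    using x KT by (intro subsetD[OF closure_of_subset]) auto
  then show False using i by (simp add: U_def)
qed

text \<open>Alaoglu's argument: the evaluations at the \<open>x n\<close> lie in a product of
  compact intervals, and a cluster point there is again linear and bounded, hence an element of the
  bidual.\<close>

lemma weak_star_cluster_point:
  fixes x :: "nat \<Rightarrow> 'a::real_normed_vector"
  assumes B: "\<And>n. norm (x n) \<le> B"
  shows "\<exists>u. \<forall>l. u \<in> weak_star_topology closure_of (bidual_embedding ` x ` {l..})"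
proof -
  define h where "h n = (\<lambda>f :: 'a \<Rightarrow>\<^sub>L real. blinfun_apply f (x n))" for n
  define K where "K = (\<Pi>\<^sub>E f\<in>UNIV. cball (0::real) (B * norm (f :: 'a \<Rightarrow>\<^sub>L real)))"
  have hb: "\<bar>h n f\<bar> \<le> B * norm f" for n f
  proof -
    have "\<bar>h n f\<bar> \<le> norm f * norm (x n)" using norm_blinfun[of f "x n"] by (simp add: h_def)
    also have "\<dots> \<le> norm f * B" by (intro mult_left_mono B) auto
    finally show ?thesis by (simp add: mult.commute)
  qed
  have "compactin euclidean K"
    unfolding K_def euclidean_product_topology[symmetric] compactin_PiE by auto
  moreover have "h n \<in> K" for n using hb by (auto simp: K_def)
  ultimately obtain z where "\<forall>l. z \<in> euclidean closure_of (h ` {l..})"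
    using compactin_cluster_point by blast
  then have z: "z \<in> closure (h ` {l..})" for l by simp
  \<comment> \<open>Closed conditions met by all evaluations pass to \<open>z\<close>; additivity,
    homogeneity and the norm bound are of this kind.\<close>
  have mem: "z \<in> C" if "closed C" "\<And>n. h n \<in> C" for C
    using closure_minimal[of "h ` {0..}" C] that z[of 0] by blast
  have cont: "continuous_on UNIV (\<lambda>z :: ('a \<Rightarrow>\<^sub>L real) \<Rightarrow> real. z f)" for f
    by (rule continuous_on_product_coordinates)
  have "bounded_linear z"
  proof
    fix f g :: "'a \<Rightarrow>\<^sub>L real" and c :: real
    have "closed {z :: ('a \<Rightarrow>\<^sub>L real) \<Rightarrow> real. z (f + g) = z f + z g}"
      by (intro closed_Collect_eq continuous_intros cont)
    from mem[OF this] show "z (f + g) = z f + z g" by (simp add: h_def blinfun.add_left)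
    have "closed {z :: ('a \<Rightarrow>\<^sub>L real) \<Rightarrow> real. z (c *\<^sub>R f) = c *\<^sub>R z f}"
      by (intro closed_Collect_eq continuous_intros cont)
    from mem[OF this] show "z (c *\<^sub>R f) = c *\<^sub>R z f" by (simp add: h_def blinfun.scaleR_left)
  next
    have "\<bar>z f\<bar> \<le> B * norm f" for f
    proof -
      have "closed {z :: ('a \<Rightarrow>\<^sub>L real) \<Rightarrow> real. \<bar>z f\<bar> \<le> B * norm f}"
        by (intro closed_Collect_le continuous_intros cont)
      from mem[OF this] show ?thesis using hb by simp
    qed
    then show "\<exists>K. \<forall>f. norm (z f) \<le> norm f * K" by (auto simp: mult.commute intro!: exI[of _ B])
  qed
  then have zB: "blinfun_apply (Blinfun z) = z" by (rule bounded_linear_Blinfun_apply)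
  have hx: "blinfun_apply (bidual_embedding (x n)) = h n" for n
    by (simp add: h_def bidual_embedding.rep_eq)
  have "Blinfun z \<in> weak_star_topology closure_of (bidual_embedding ` x ` {l..})" for l
    unfolding in_closure_of
  proof (intro conjI allI impI)
    fix V assume "Blinfun z \<in> V \<and> openin weak_star_topology V"
    then obtain U where U: "open U" "V = blinfun_apply -` U" "z \<in> U"
      by (auto simp: strong_operator_topology_def openin_pullback_topology zB)
    then have "U \<inter> h ` {l..} \<noteq> {}"
      using z[of l] open_Int_closure_eq_empty[OF U(1)] by blast
    then obtain n where "n \<ge> l" "h n \<in> U" by auto
    then show "\<exists>y. y \<in> bidual_embedding ` x ` {l..} \<and> y \<in> V"
      using U hx by (intro exI[of _ "bidual_embedding (x n)"]) auto
  qed (simp add: strong_operator_topology_topspace)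
  then show ?thesis by blast
qed

section \<open>Coordinates and blocks\<close>

definition coord :: "ell1 l2_sum \<Rightarrow> nat \<times> nat \<Rightarrow> real" where
  "coord x = (\<lambda>(m, i). ell1_nth (l2_nth x m) i)"

lemma coord_simps [simp]:
  "coord 0 q = 0" "coord (x + y) q = coord x q + coord y q" "coord (x - y) q = coord x q - coord y q"
  "coord (- x) q = - coord x q" "coord (c *\<^sub>R x) q = c * coord x q"
  by (auto simp: coord_def zero_ell1.rep_eq zero_l2_sum.rep_eq plus_ell1.rep_eq plus_l2_sum.rep_eq
      minus_ell1.rep_eq minus_l2_sum.rep_eq uminus_ell1.rep_eq uminus_l2_sum.rep_eq
      scaleR_ell1.rep_eq scaleR_l2_sum.rep_eq split: prod.splits)

lemma coord_eqI: "(\<And>q. coord x q = coord y q) \<Longrightarrow> x = y"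
  by (auto simp: coord_def split_paired_all l2_nth_inject[symmetric] ell1_nth_inject[symmetric] fun_eq_iff)

lemma column_norm: "norm (l2_nth x m) = (\<Sum>i. \<bar>coord x (m, i)\<bar>)"
  by (simp add: coord_def norm_ell1.rep_eq)

lemma summable_coord: "summable (\<lambda>i. \<bar>coord x (m, i)\<bar>)"
  by (simp add: coord_def summable_ell1)

lemma norm_eq_column_norms: "(norm (x :: ell1 l2_sum))\<^sup>2 = (\<Sum>m. (norm (l2_nth x m))\<^sup>2)"
  unfolding norm_l2_sum.rep_eq by (intro real_sqrt_pow2 suminf_nonneg summable_l2_sum) auto

lemma partial_sums_le_norm:
  "L2_set (\<lambda>m. \<Sum>i<N. \<bar>coord x (m, i)\<bar>) {..<M} \<le> norm x"
proof -
  have "L2_set (\<lambda>m. \<Sum>i<N. \<bar>coord x (m, i)\<bar>) {..<M} \<le> L2_set (\<lambda>m. norm (l2_nth x m)) {..<M}"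
    by (intro L2_set_mono) (auto simp: coord_def sum_le_norm_ell1 sum_nonneg)
  then show ?thesis using L2_set_le_norm_l2_sum order_trans by blast
qed

text \<open>The norm is the supremum of the norms of finite rectangular sections, so a bound on the
  sections produces a vector. All constructions of vectors below rest on this.\<close>

lemma coord_surj_bounded:
  assumes B: "\<And>M N. L2_set (\<lambda>m. \<Sum>i<N. \<bar>c (m, i)\<bar>) {..<M} \<le> B"
  shows "\<exists>x. coord x = c \<and> norm x \<le> B"
proof -
  have le: "(\<Sum>i<N. \<bar>c (m, i)\<bar>) \<le> B" for m N
    using member_le_L2_set[of "{..<Suc m}" m "\<lambda>m. \<Sum>i<N. \<bar>c (m, i)\<bar>"] B[of N "Suc m"] by simp
  then have sm: "summable (\<lambda>i. \<bar>c (m, i)\<bar>)" for m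
    by (intro summableI_nonneg_bounded[of _ B]) auto
  define a where "a m = Abs_ell1 (\<lambda>i. c (m, i))" for m
  have a: "ell1_nth (a m) = (\<lambda>i. c (m, i))" for m
    using sm by (simp add: a_def Abs_ell1_inverse)
  \<comment> \<open>The number \<open>M\<close> of columns stays fixed while their length
    \<open>N\<close> tends to infinity.\<close>
  have "L2_set (\<lambda>m. norm (a m)) {..<M} \<le> B" for M
  proof (rule LIMSEQ_le_const2)
    show "(\<lambda>N. L2_set (\<lambda>m. \<Sum>i<N. \<bar>c (m, i)\<bar>) {..<M}) \<longlonglongrightarrow> L2_set (\<lambda>m. norm (a m)) {..<M}"
      unfolding L2_set_def norm_ell1.rep_eq a
      by (intro tendsto_intros summable_LIMSEQ sm)
  qed (use B in auto)
  note L = L2_set_bounded_imp[OF this]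
  have n: "l2_nth (Abs_l2_sum a) = a" using L(1) by (simp add: Abs_l2_sum_inverse)
  then have "coord (Abs_l2_sum a) = c" by (auto simp: coord_def a fun_eq_iff)
  moreover have "norm (Abs_l2_sum a) \<le> B" using L(2) by (simp add: norm_l2_sum.rep_eq n)
  ultimately show ?thesis by blast
qed

text \<open>Finite sections depend continuously on their finitely many entries, so their bounds
  survive the limit: the norm is lower semicontinuous for coordinatewise convergence.\<close>

lemma coord_limit:
  assumes lim: "\<And>q. (\<lambda>n. coord (x n) q) \<longlonglongrightarrow> c q" and B: "\<forall>\<^sub>F n in sequentially. norm (x n) \<le> B"
  shows "\<exists>y. coord y = c \<and> norm y \<le> B"
proof (rule coord_surj_bounded, rule tendsto_upperbound)
  fix M N
  show "(\<lambda>n. L2_set (\<lambda>m. \<Sum>i<N. \<bar>coord (x n) (m, i)\<bar>) {..<M}) \<longlonglongrightarrow> L2_set (\<lambda>m. \<Sum>i<N. \<bar>c (m, i)\<bar>) {..<M}"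
    unfolding L2_set_def by (intro tendsto_intros lim)
  show "\<forall>\<^sub>F n in sequentially. L2_set (\<lambda>m. \<Sum>i<N. \<bar>coord (x n) (m, i)\<bar>) {..<M} \<le> B"
    using B by eventually_elim (use partial_sums_le_norm order_trans in blast)
qed simp

lemma norm_limit:
  assumes "\<And>q. (\<lambda>n. coord (x n) q) \<longlonglongrightarrow> coord y q" "\<forall>\<^sub>F n in sequentially. norm (x n) \<le> B"
  shows "norm y \<le> B"
  using coord_limit[OF assms] coord_eqI by metis

lemma norm_mono_coord:
  assumes "\<And>q. \<bar>coord x q\<bar> \<le> \<bar>coord y q\<bar>"
  shows "norm x \<le> norm y"
proof -
  have "\<exists>x'. coord x' = coord x \<and> norm x' \<le> norm y"
  proof (rule coord_surj_bounded)
    fix M N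
    have "L2_set (\<lambda>m. \<Sum>i<N. \<bar>coord x (m, i)\<bar>) {..<M} \<le> L2_set (\<lambda>m. \<Sum>i<N. \<bar>coord y (m, i)\<bar>) {..<M}"
      by (intro L2_set_mono sum_mono assms sum_nonneg) auto
    then show "L2_set (\<lambda>m. \<Sum>i<N. \<bar>coord x (m, i)\<bar>) {..<M} \<le> norm y"
      using partial_sums_le_norm order_trans by blast
  qed
  then show ?thesis using coord_eqI by metis
qed

lemma abs_coord_le_norm: "\<bar>coord x q\<bar> \<le> norm x"
  using abs_nth_le_norm_ell1[of "l2_nth x (fst q)" "snd q"] norm_nth_le_norm_l2_sum[of x "fst q"]
  by (simp add: coord_def case_prod_beta)

lemma coord_surj_finite:
  assumes A: "finite A" and c: "\<And>q. q \<notin> A \<Longrightarrow> c q = 0"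
  shows "\<exists>x. coord x = c \<and> norm x \<le> (\<Sum>q\<in>A. \<bar>c q\<bar>)"
proof (rule coord_surj_bounded)
  fix M N
  have "L2_set (\<lambda>m. \<Sum>i<N. \<bar>c (m, i)\<bar>) {..<M} \<le> (\<Sum>m<M. \<Sum>i<N. \<bar>c (m, i)\<bar>)"
    by (intro L2_set_le_sum sum_nonneg) auto
  also have "\<dots> = (\<Sum>q\<in>{..<M} \<times> {..<N}. \<bar>c q\<bar>)"
    by (simp add: sum.cartesian_product case_prod_beta)
  also have "\<dots> = (\<Sum>q\<in>({..<M} \<times> {..<N}) \<inter> A. \<bar>c q\<bar>)"
    using c by (intro sum.mono_neutral_right) auto
  also have "\<dots> \<le> (\<Sum>q\<in>A. \<bar>c q\<bar>)"
    by (intro sum_mono2 A) auto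
  finally show "L2_set (\<lambda>m. \<Sum>i<N. \<bar>c (m, i)\<bar>) {..<M} \<le> (\<Sum>q\<in>A. \<bar>c q\<bar>)" .
qed

section \<open>Unit vectors, multipliers and projections\<close>

definition unit_vec :: "nat \<times> nat \<Rightarrow> ell1 l2_sum" where
  "unit_vec q = (SOME x. coord x = indicat_real {q} \<and> norm x \<le> 1)"

lemma unit_vec: "coord (unit_vec q) = indicat_real {q}" "norm (unit_vec q) \<le> 1"
proof -
  have "\<exists>x. coord x = indicat_real {q} \<and> norm x \<le> 1"
    using coord_surj_finite[of "{q}" "indicat_real {q}"] by auto
  from someI_ex[OF this] show "coord (unit_vec q) = indicat_real {q}" "norm (unit_vec q) \<le> 1"
    by (auto simp: unit_vec_def)
qed

text \<open>For \<open>s\<close> bounded by \<open>1\<close> such a vector exists and is unique.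
  Indicators give projections, signs give norming functionals.\<close>

definition multiplier :: "(nat \<times> nat \<Rightarrow> real) \<Rightarrow> ell1 l2_sum \<Rightarrow> ell1 l2_sum" where
  "multiplier s x = (SOME y. coord y = (\<lambda>q. s q * coord x q))"

lemma coord_multiplier:
  assumes "\<And>q. \<bar>s q\<bar> \<le> 1"
  shows "coord (multiplier s x) q = s q * coord x q"
proof -
  have "\<exists>y. coord y = (\<lambda>q. s q * coord x q) \<and> norm y \<le> norm x"
  proof (rule coord_surj_bounded)
    fix M N
    have "L2_set (\<lambda>m. \<Sum>i<N. \<bar>s (m, i) * coord x (m, i)\<bar>) {..<M}
        \<le> L2_set (\<lambda>m. \<Sum>i<N. \<bar>coord x (m, i)\<bar>) {..<M}"
      by (intro L2_set_mono sum_mono sum_nonneg) (auto simp: abs_mult mult_left_le_one_le assms)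
    then show "L2_set (\<lambda>m. \<Sum>i<N. \<bar>s (m, i) * coord x (m, i)\<bar>) {..<M} \<le> norm x"
      using partial_sums_le_norm order_trans by blast
  qed
  then have "\<exists>y. coord y = (\<lambda>q. s q * coord x q)" by blast
  from someI_ex[OF this] show ?thesis by (simp add: multiplier_def)
qed

lemma bounded_linear_multiplier:
  assumes s: "\<And>q. \<bar>s q\<bar> \<le> 1"
  shows "bounded_linear (multiplier s)"
proof
  show "multiplier s (x + y) = multiplier s x + multiplier s y" for x y
    by (rule coord_eqI) (simp add: coord_multiplier s algebra_simps)
  show "multiplier s (c *\<^sub>R x) = c *\<^sub>R multiplier s x" for c x
    by (rule coord_eqI) (simp add: coord_multiplier s)
  have "norm (multiplier s x) \<le> norm x * 1" for x
    using norm_mono_coord[of "multiplier s x" x] s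
    by (simp add: coord_multiplier abs_mult mult_left_le_one_le)
  then show "\<exists>K. \<forall>x. norm (multiplier s x) \<le> norm x * K" by blast
qed

definition proj :: "(nat \<times> nat) set \<Rightarrow> ell1 l2_sum \<Rightarrow> ell1 l2_sum" where
  "proj A = multiplier (indicator A)"

lemma coord_proj [simp]: "coord (proj A x) q = (if q \<in> A then coord x q else 0)"
  by (simp add: proj_def coord_multiplier indicator_def)

lemma bounded_linear_proj: "bounded_linear (proj A)"
  unfolding proj_def by (rule bounded_linear_multiplier) (simp add: indicator_def)

lemma proj_diff: "proj A (x - y) = proj A x - proj A y"
  by (rule linear_diff) (simp add: bounded_linear.linear bounded_linear_proj)

lemma norm_proj_le: "norm (proj A x) \<le> norm x"
  by (rule norm_mono_coord) auto

lemma norm_proj_mono: "A \<subseteq> B \<Longrightarrow> norm (proj A x) \<le> norm (proj B x)"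
  by (rule norm_mono_coord) auto

lemma norm_proj_finite:
  assumes "finite A"
  shows "norm (proj A x) \<le> (\<Sum>q\<in>A. \<bar>coord x q\<bar>)"
proof -
  obtain y where "coord y = coord (proj A x)" "norm y \<le> (\<Sum>q\<in>A. \<bar>coord (proj A x) q\<bar>)"
    using coord_surj_finite[OF assms, of "coord (proj A x)"] by auto
  moreover from this have "y = proj A x" by (intro coord_eqI) simp
  ultimately show ?thesis by simp
qed

lemma norm_single_column:
  assumes "\<And>m' i. m' \<noteq> m \<Longrightarrow> coord x (m', i) = 0"
  shows "norm x = (\<Sum>i. \<bar>coord x (m, i)\<bar>)"
proof -
  have "(norm x)\<^sup>2 = (\<Sum>m'\<in>{m}. (norm (l2_nth x m'))\<^sup>2)"
    unfolding norm_eq_column_norms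
    by (rule suminf_finite) (auto simp: column_norm assms)
  then have "norm x = norm (l2_nth x m)" by simp
  then show ?thesis by (simp add: column_norm)
qed

section \<open>Functionals on a single column\<close>

lemma bounded_linear_column_sum: "bounded_linear (\<lambda>x. \<Sum>i. coord x (m, i))"
  and abs_column_sum_le: "\<bar>\<Sum>i. coord x (m, i)\<bar> \<le> norm x"
proof -
  have s: "summable (\<lambda>i. coord x (m, i))" for x
    by (rule summable_rabs_cancel[OF summable_coord])
  have le: "\<bar>\<Sum>i. coord x (m, i)\<bar> \<le> norm x" for x
  proof -
    have "\<bar>\<Sum>i. coord x (m, i)\<bar> \<le> norm (l2_nth x m)"
      unfolding column_norm by (rule summable_rabs[OF summable_coord])
    also have "\<dots> \<le> norm x" by (rule norm_nth_le_norm_l2_sum)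
    finally show ?thesis .
  qed
  show "bounded_linear (\<lambda>x. \<Sum>i. coord x (m, i))"
  proof
    show "(\<Sum>i. coord (x + y) (m, i)) = (\<Sum>i. coord x (m, i)) + (\<Sum>i. coord y (m, i))" for x y
      by (simp add: suminf_add s)
    show "(\<Sum>i. coord (c *\<^sub>R x) (m, i)) = c *\<^sub>R (\<Sum>i. coord x (m, i))" for c x
      by (simp add: suminf_mult s)
    show "\<exists>K. \<forall>x. norm (\<Sum>i. coord x (m, i)) \<le> norm x * K"
      using le by (intro exI[of _ 1]) simp
  qed
  show "\<bar>\<Sum>i. coord x (m, i)\<bar> \<le> norm x" by (rule le)
qed

text \<open>This is the duality between \<open>\<ell>\<^sub>1\<close> and bounded sequences on the
  \<open>m\<close>-th column. It serves with signs in Schur's argument and with indicators in the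
  tail sums.\<close>

definition signed_column_sum :: "nat \<Rightarrow> (nat \<times> nat \<Rightarrow> real) \<Rightarrow> ell1 l2_sum \<Rightarrow>\<^sub>L real" where
  "signed_column_sum m s = Blinfun (\<lambda>x. \<Sum>i. coord (multiplier s x) (m, i))"

lemma signed_column_sum:
  assumes s: "\<And>q. \<bar>s q\<bar> \<le> 1"
  shows "blinfun_apply (signed_column_sum m s) x = (\<Sum>i. s (m, i) * coord x (m, i))"
    and "\<bar>blinfun_apply (signed_column_sum m s) x\<bar> \<le> norm x"
    and "norm (signed_column_sum m s) \<le> 1"
proof -
  have "bounded_linear (\<lambda>x. \<Sum>i. coord (multiplier s x) (m, i))"
    using bounded_linear_compose[OF bounded_linear_column_sum bounded_linear_multiplier[OF s]] by simp
  then have eq: "blinfun_apply (signed_column_sum m s) x = (\<Sum>i. coord (multiplier s x) (m, i))" for x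
    by (simp add: signed_column_sum_def bounded_linear_Blinfun_apply)
  then show "blinfun_apply (signed_column_sum m s) x = (\<Sum>i. s (m, i) * coord x (m, i))"
    by (simp add: coord_multiplier s)
  have "norm (multiplier s x) \<le> norm x" for x
    by (rule norm_mono_coord) (simp add: coord_multiplier s abs_mult mult_left_le_one_le)
  then have le: "\<bar>blinfun_apply (signed_column_sum m s) x\<bar> \<le> norm x" for x
    using abs_column_sum_le[of "multiplier s x" m] unfolding eq by (meson order_trans)
  then show "\<bar>blinfun_apply (signed_column_sum m s) x\<bar> \<le> norm x" .
  show "norm (signed_column_sum m s) \<le> 1" using le by (intro norm_blinfun_bound) auto
qed

section \<open>Exhaustion by squares and the gliding hump\<close>

definition square :: "nat \<Rightarrow> (nat \<times> nat) set" where
  "square N = {..<N} \<times> {..<N}"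

lemma finite_square [simp]: "finite (square N)"
  by (simp add: square_def)

lemma square_mono: "M \<le> N \<Longrightarrow> square M \<subseteq> square N"
  by (auto simp: square_def)

lemma suminf_dominated_null:
  fixes a :: "nat \<Rightarrow> nat \<Rightarrow> real"
  assumes lim: "\<And>k. (\<lambda>n. a k n) \<longlonglongrightarrow> 0" and bound: "\<And>k n. \<bar>a k n\<bar> \<le> M k" and M: "summable M"
  shows "(\<lambda>n. \<Sum>k. a k n) \<longlonglongrightarrow> 0"
proof -
  have "\<forall>\<^sub>F (k, n) in sequentially \<times>\<^sub>F sequentially. norm (a k n) \<le> M k"
    by (rule always_eventually) (simp add: bound)
  from tannerys_theorem[OF lim this M] show ?thesis by simp
qed

text \<open>Dominated convergence is used twice: within each column, majorised by the entries of
  \<open>x\<close>, and then across the columns, majorised by the squared column norms.\<close>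

lemma proj_square_tail: "(\<lambda>N. norm (proj (- square N) x)) \<longlonglongrightarrow> 0"
proof -
  have col: "(\<lambda>N. norm (l2_nth (proj (- square N) x) m)) \<longlonglongrightarrow> 0" for m
  proof -
    have "(\<lambda>N. \<bar>coord (proj (- square N) x) (m, i)\<bar>) \<longlonglongrightarrow> 0" for i
      by (rule tendsto_eventually)
        (use eventually_ge_at_top[of "Suc (max m i)"] in eventually_elim, auto simp: square_def)
    then have "(\<lambda>N. \<Sum>i. \<bar>coord (proj (- square N) x) (m, i)\<bar>) \<longlonglongrightarrow> 0"
      by (rule suminf_dominated_null[OF _ _ summable_coord[of x m]]) simp
    then show ?thesis by (simp add: column_norm)
  qed
  have "norm (l2_nth (proj (- square N) x) m) \<le> norm (l2_nth x m)" for m N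
    unfolding column_norm by (intro suminf_le summable_coord) auto
  then have "(\<lambda>N. \<Sum>m. (norm (l2_nth (proj (- square N) x) m))\<^sup>2) \<longlonglongrightarrow> 0"
    using tendsto_power[OF col, of _ 2]
    by (intro suminf_dominated_null[OF _ _ summable_l2_sum[of x]]) (auto intro: power_mono)
  then have "(\<lambda>N. sqrt ((norm (proj (- square N) x))\<^sup>2)) \<longlonglongrightarrow> sqrt 0"
    unfolding norm_eq_column_norms by (intro tendsto_real_sqrt) simp
  then show ?thesis by simp
qed

lemma proj_finite_tendsto_0:
  assumes "\<And>q. (\<lambda>n. coord (y n) q) \<longlonglongrightarrow> 0" "finite A"
  shows "(\<lambda>n. norm (proj A (y n))) \<longlonglongrightarrow> 0"
proof (rule Lim_null_comparison)
  show "(\<lambda>n. \<Sum>q\<in>A. \<bar>coord (y n) q\<bar>) \<longlonglongrightarrow> 0"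
    by (rule tendsto_null_sum) (use assms tendsto_rabs_zero in blast)
qed (use norm_proj_finite[OF assms(2)] in auto)

text \<open>Choose alternately a term that is almost null on the square already reached and a larger
  square outside which this term is almost null.\<close>

lemma gliding_hump:
  assumes y: "\<And>q. (\<lambda>n. coord (y n) q) \<longlonglongrightarrow> 0" and e: "e > 0"
  shows "\<exists>r N. strict_mono r \<and> strict_mono N \<and>
    (\<forall>k::nat. norm (proj (- (square (N (Suc k)) - square (N k))) (y (r k))) \<le> e)"
proof -
  define P where "P = (\<lambda>(r::nat, N::nat) (r', N'). r < r' \<and> N < N' \<and> norm (proj (square N) (y r')) \<le> e / 2
     \<and> norm (proj (- square N') (y r')) \<le> e / 2)"
  have step: "\<exists>b. P a b" for a
  proof -
    obtain r N where a: "a = (r, N)" by force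
    have "\<forall>\<^sub>F n in sequentially. norm (proj (square N) (y n)) < e / 2 \<and> n > r"
      using order_tendstoD(2)[OF proj_finite_tendsto_0[OF y finite_square], of "e / 2"] e
      by (intro eventually_conj eventually_gt_at_top) auto
    then obtain r' where r': "norm (proj (square N) (y r')) < e / 2" "r' > r"
      by (auto simp: eventually_sequentially)
    have "\<forall>\<^sub>F n in sequentially. norm (proj (- square n) (y r')) < e / 2 \<and> n > N"
      using order_tendstoD(2)[OF proj_square_tail, of "e / 2"] e
      by (intro eventually_conj eventually_gt_at_top) auto
    then obtain N' where N': "norm (proj (- square N') (y r')) < e / 2" "N' > N"
      by (auto simp: eventually_sequentially)
    show ?thesis using r' N' by (intro exI[of _ "(r', N')"]) (auto simp: P_def a)
  qed
  obtain g where g: "\<And>k::nat. P (g k) (g (Suc k))"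
    using dependent_nat_choice[of "\<lambda>_ _. True" "\<lambda>_. P"] step by auto
  \<comment> \<open>The term \<open>y (r k)\<close> belongs to the step from \<open>g k\<close> to
    \<open>g (Suc k)\<close>, hence the shift in \<open>r\<close> and not in
    \<open>N\<close>.\<close>
  define r where "r k = fst (g (Suc k))" for k
  define N where "N k = snd (g k)" for k
  have "strict_mono r" "strict_mono N"
    using g unfolding P_def by (auto intro!: strict_monoI_Suc simp: r_def N_def case_prod_beta)
  moreover have "norm (proj (- (square (N (Suc k)) - square (N k))) (y (r k))) \<le> e" for k
  proof -
    let ?z = "y (r k)"
    have "N k < N (Suc k)" using \<open>strict_mono N\<close> by (simp add: strict_mono_Suc_iff)
    then have "proj (- (square (N (Suc k)) - square (N k))) ?z
        = proj (square (N k)) ?z + proj (- square (N (Suc k))) ?z"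
      using square_mono[of "N k" "N (Suc k)"] by (intro coord_eqI) auto
    also have "norm \<dots> \<le> e / 2 + e / 2"
      using g[of k] by (intro norm_triangle_mono) (auto simp: P_def r_def N_def case_prod_beta)
    finally show ?thesis by simp
  qed
  ultimately show ?thesis by blast
qed

section \<open>Weakly convergent sequences\<close>

lemma coord_functional: "\<exists>f :: ell1 l2_sum \<Rightarrow>\<^sub>L real. \<forall>x. blinfun_apply f x = coord x q"
proof -
  have "bounded_linear (\<lambda>x. coord x q)"
    by (rule bounded_linear_intro[where K = 1]) (simp_all add: abs_coord_le_norm)
  from bounded_linear_Blinfun_apply[OF this] show ?thesis by metis
qed

lemma blocks_disjoint:
  assumes "strict_mono N" "q \<in> square (N (Suc j)) - square (N j)" "q \<in> square (N (Suc k)) - square (N k)"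
  shows "j = k"
proof -
  have "\<not> j' < k'" if "q \<in> square (N (Suc j')) - square (N j')" "q \<in> square (N (Suc k')) - square (N k')" for j' k'
  proof
    assume "j' < k'"
    then have "N (Suc j') \<le> N k'" using assms(1) by (simp add: strict_mono_less_eq)
    then show False using that square_mono by blast
  qed
  from this[of j k] this[of k j] assms show ?thesis by fastforce
qed

lemma abs_functional_le:
  fixes f :: "'a::real_normed_vector \<Rightarrow>\<^sub>L real"
  assumes "norm x \<le> e"
  shows "\<bar>blinfun_apply f x\<bar> \<le> norm f * e"
  using norm_blinfun[of f x] mult_left_mono[OF assms, of "norm f"] by simp

text \<open>If \<open>f (y n)\<close> had a nonzero limit, then \<open>f\<close> composed with the restriction to every other block
  of a gliding hump would oscillate.\<close>

lemma weakly_Cauchy_null: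
  fixes y :: "nat \<Rightarrow> ell1 l2_sum" and f :: "ell1 l2_sum \<Rightarrow>\<^sub>L real"
  assumes wc: "weakly_Cauchy y" and y: "\<And>q. (\<lambda>n. coord (y n) q) \<longlonglongrightarrow> 0"
  shows "(\<lambda>n. blinfun_apply f (y n)) \<longlonglongrightarrow> 0"
proof -
  have conv: "\<exists>c. (\<lambda>n. blinfun_apply g (y n)) \<longlonglongrightarrow> c" for g :: "ell1 l2_sum \<Rightarrow>\<^sub>L real"
    using wc by (simp add: weakly_Cauchy_def Cauchy_convergent_iff convergent_def)
  then obtain c where c: "(\<lambda>n. blinfun_apply f (y n)) \<longlonglongrightarrow> c" by blast
  have le: "\<bar>c\<bar> \<le> 2 * norm f * e" if "e > 0" for e
  proof -
    obtain r N where r: "strict_mono r" and N: "strict_mono N"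
      and rN: "\<And>k::nat. norm (proj (- (square (N (Suc k)) - square (N k))) (y (r k))) \<le> e"
      using gliding_hump[OF y \<open>e > 0\<close>] by blast
    \<comment> \<open>The even blocks: \<open>g\<close> is within \<open>norm f * e\<close> of
      \<open>0\<close> at the odd terms and of \<open>f\<close> at the even ones. This bounds
      \<open>d\<close> and \<open>c - d\<close>.\<close>
    define A where "A = (\<Union>k. square (N (Suc (2 * k))) - square (N (2 * k)))"
    define g where "g = f o\<^sub>L Blinfun (proj A)"
    have g: "blinfun_apply g x = blinfun_apply f (proj A x)" for x
      by (simp add: g_def bounded_linear_Blinfun_apply bounded_linear_proj)
    obtain d where d: "(\<lambda>n. blinfun_apply g (y n)) \<longlonglongrightarrow> d" using conv by blast
    have sub: "strict_mono (\<lambda>k. r (2 * k))" "strict_mono (\<lambda>k. r (2 * k + 1))"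
      using r by (auto simp: strict_mono_def)
    have odd: "\<bar>blinfun_apply g (y (r (2 * k + 1)))\<bar> \<le> norm f * e" for k
    proof -
      let ?k = "2 * k + 1"
      have "2 * j \<noteq> ?k" for j by presburger
      then have "A \<subseteq> - (square (N (Suc ?k)) - square (N ?k))"
        unfolding A_def using blocks_disjoint[OF N, of _ _ ?k] by blast
      then have "norm (proj A (y (r ?k))) \<le> e"
        using rN[of ?k] norm_proj_mono order_trans by blast
      then show ?thesis unfolding g by (rule abs_functional_le)
    qed
    have even: "\<bar>blinfun_apply f (y (r (2 * k))) - blinfun_apply g (y (r (2 * k)))\<bar> \<le> norm f * e" for k
    proof -
      let ?x = "y (r (2 * k))"
      have "norm (proj (- A) ?x) \<le> norm (proj (- (square (N (Suc (2 * k))) - square (N (2 * k)))) ?x)"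
        by (rule norm_proj_mono) (auto simp: A_def)
      then have "norm (proj (- A) ?x) \<le> e" using rN[of "2 * k"] by linarith
      moreover have "?x - proj A ?x = proj (- A) ?x" by (rule coord_eqI) simp
      ultimately show ?thesis
        unfolding g blinfun.diff_right[symmetric] by (intro abs_functional_le) simp
    qed
    have "\<bar>d\<bar> \<le> norm f * e"
    proof (rule LIMSEQ_le_const2)
      show "(\<lambda>k. \<bar>blinfun_apply g (y (r (2 * k + 1)))\<bar>) \<longlonglongrightarrow> \<bar>d\<bar>"
        using LIMSEQ_subseq_LIMSEQ[OF d sub(2)] by (intro tendsto_rabs) (simp add: comp_def)
    qed (use odd in auto)
    moreover have "\<bar>c - d\<bar> \<le> norm f * e"
    proof (rule LIMSEQ_le_const2)
      show "(\<lambda>k. \<bar>blinfun_apply f (y (r (2 * k))) - blinfun_apply g (y (r (2 * k)))\<bar>) \<longlonglongrightarrow> \<bar>c - d\<bar>"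
        using LIMSEQ_subseq_LIMSEQ[OF d sub(1)] LIMSEQ_subseq_LIMSEQ[OF c sub(1)]
        by (intro tendsto_rabs tendsto_diff) (simp_all add: comp_def)
    qed (use even in auto)
    ultimately show ?thesis by linarith
  qed
  have "\<bar>c\<bar> \<le> 0"
  proof (rule field_le_epsilon)
    fix e :: real assume "0 < e"
    have pos: "0 < 2 * norm f + 1" by (simp add: add_nonneg_pos)
    have "\<bar>c\<bar> \<le> 2 * norm f * (e / (2 * norm f + 1))"
      using \<open>0 < e\<close> pos by (intro le) simp
    also have "\<dots> \<le> e"
      using \<open>0 < e\<close> pos by (simp add: pos_divide_le_eq algebra_simps)
    finally show "\<bar>c\<bar> \<le> 0 + e" by simp
  qed
  then show ?thesis using c by simp
qed

text \<open>The coordinates converge, and uniform boundedness places their limit in the space. The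
  differences from it are weakly Cauchy and coordinatewise null, hence weakly null.\<close>

lemma weakly_sequentially_complete_l2_sum_ell1: "weakly_sequentially_complete TYPE(ell1 l2_sum)"
  unfolding weakly_sequentially_complete_def
proof (intro allI impI)
  fix s :: "nat \<Rightarrow> ell1 l2_sum"
  assume s: "weakly_Cauchy s"
  have Cauchy: "Cauchy (\<lambda>n. blinfun_apply f (s n))" for f :: "ell1 l2_sum \<Rightarrow>\<^sub>L real"
    using s by (simp add: weakly_Cauchy_def)
  have "\<exists>c. (\<lambda>n. coord (s n) q) \<longlonglongrightarrow> c" for q
    using Cauchy coord_functional[of q] by (metis (no_types, lifting) Cauchy_convergent_iff convergent_def ext)
  then obtain c where c: "\<And>q. (\<lambda>n. coord (s n) q) \<longlonglongrightarrow> c q" by metis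
  have "bounded (blinfun_apply f ` range s)" for f :: "ell1 l2_sum \<Rightarrow>\<^sub>L real"
    using cauchy_imp_bounded[OF Cauchy, of f] by (simp add: image_image)
  then have "bounded (range s)" by (rule weakly_bounded_imp_bounded)
  then obtain B where B: "\<And>n. norm (s n) \<le> B" by (auto simp: bounded_iff)
  obtain x where x: "coord x = c" using coord_limit[OF c, of B] B by auto
  define y where "y n = s n - x" for n
  have "weakly_Cauchy y"
    unfolding weakly_Cauchy_def
  proof
    fix f :: "ell1 l2_sum \<Rightarrow>\<^sub>L real"
    have "convergent (\<lambda>n. blinfun_apply f (s n))" using Cauchy by (simp add: Cauchy_convergent_iff)
    then have "convergent (\<lambda>n. blinfun_apply f (s n) - blinfun_apply f x)"
      by (intro convergent_diff convergent_const)
    then show "Cauchy (\<lambda>n. blinfun_apply f (y n))"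
      by (simp add: y_def blinfun.diff_right Cauchy_convergent_iff)
  qed
  moreover have "(\<lambda>n. coord (y n) q) \<longlonglongrightarrow> 0" for q
    using c[of q] by (simp add: y_def x LIM_zero_iff)
  ultimately have "(\<lambda>n. blinfun_apply f (y n)) \<longlonglongrightarrow> 0" for f :: "ell1 l2_sum \<Rightarrow>\<^sub>L real"
    by (rule weakly_Cauchy_null)
  then have "limitin weak_topology s x sequentially"
    by (intro limitin_weak_topology) (simp add: y_def blinfun.diff_right LIM_zero_iff)
  then show "\<exists>x. limitin weak_topology s x sequentially" by blast
qed

section \<open>Decay of functionals along the columns\<close>

lemma column_zero_iff: "l2_nth x m = 0 \<longleftrightarrow> (\<forall>i. coord x (m, i) = 0)"
  by (auto simp: coord_def zero_ell1.rep_eq ell1_nth_inject[symmetric] fun_eq_iff)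

lemma norm_add_disjoint_columns:
  fixes x y :: "ell1 l2_sum"
  assumes "\<And>m. l2_nth x m = 0 \<or> l2_nth y m = 0"
  shows "(norm (x + y))\<^sup>2 = (norm x)\<^sup>2 + (norm y)\<^sup>2"
proof -
  have "(norm (l2_nth (x + y) m))\<^sup>2 = (norm (l2_nth x m))\<^sup>2 + (norm (l2_nth y m))\<^sup>2" for m
    using assms[of m] by (auto simp: plus_l2_sum.rep_eq)
  then show ?thesis
    unfolding norm_eq_column_norms by (simp add: suminf_add summable_l2_sum)
qed

text \<open>Otherwise one finds \<open>K\<close> normalised vectors in disjoint columns on which \<open>f\<close> is at least \<open>e\<close>;
  their sum has norm \<open>sqrt K\<close>, contradicting \<open>K * e \<le> norm f * sqrt K\<close> for large \<open>K\<close>.\<close>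

lemma functional_column_decay:
  fixes f :: "ell1 l2_sum \<Rightarrow>\<^sub>L real"
  assumes e: "e > 0"
  shows "\<exists>M. \<forall>x. (\<forall>m<M. l2_nth x m = 0) \<longrightarrow> \<bar>blinfun_apply f x\<bar> \<le> e * norm x"
proof (rule ccontr)
  assume "\<not> ?thesis"
  then have bad: "\<exists>x. (\<forall>m<M. l2_nth x m = 0) \<and> e * norm x < \<bar>blinfun_apply f x\<bar>" for M
    by (meson not_less)
  have "\<exists>M z. (\<forall>m\<ge>M. l2_nth z m = 0) \<and> (norm z)\<^sup>2 \<le> real K \<and> real K * e \<le> blinfun_apply f z" for K
  proof (induction K)
    case 0
    show ?case by (intro exI[of _ 0]) (simp add: zero_l2_sum.rep_eq)
  next
    case (Suc K)
    then obtain M z where z: "\<And>m. m \<ge> M \<Longrightarrow> l2_nth z m = 0" "(norm z)\<^sup>2 \<le> real K" "real K * e \<le> blinfun_apply f z"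
      by blast
    obtain x where x: "\<And>m. m < M \<Longrightarrow> l2_nth x m = 0" "e * norm x < \<bar>blinfun_apply f x\<bar>"
      using bad[of M] by blast
    have "x \<noteq> 0" using x(2) by auto
    define w where "w = (sgn (blinfun_apply f x) / norm x) *\<^sub>R x"
    have w: "norm w \<le> 1" "blinfun_apply f w > e"
      using x(2) \<open>x \<noteq> 0\<close>
      by (auto simp: w_def blinfun.scaleR_right abs_sgn_eq field_simps) (simp add: abs_sgn mult.commute)
    have "(\<lambda>N. norm (blinfun_apply f (proj (- square N) w))) \<longlonglongrightarrow> 0"
    proof (rule Lim_null_comparison)
      show "(\<lambda>N. norm f * norm (proj (- square N) w)) \<longlonglongrightarrow> 0"
        using tendsto_mult_right_zero[OF proj_square_tail] by blast
    qed (simp add: norm_blinfun[of f, unfolded real_norm_def])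
    then have "\<forall>\<^sub>F N in sequentially. \<bar>blinfun_apply f (proj (- square N) w)\<bar> < blinfun_apply f w - e \<and> N > M"
      using w by (intro eventually_conj order_tendstoD(2) eventually_gt_at_top) auto
    then obtain N where N: "\<bar>blinfun_apply f (proj (- square N) w)\<bar> < blinfun_apply f w - e" "N > M"
      by (auto simp: eventually_sequentially)
    \<comment> \<open>Cutting \<open>w\<close> down to a finite square keeps its value above
      \<open>e\<close> and leaves finitely many columns, which the next vector can avoid.\<close>
    define v where "v = proj (square N) w"
    have "w = v + proj (- square N) w" unfolding v_def by (rule coord_eqI) simp
    then have "blinfun_apply f w = blinfun_apply f v + blinfun_apply f (proj (- square N) w)"
      by (metis blinfun.add_right)
    then have fv: "blinfun_apply f v > e" using N by linarith
    have v0: "l2_nth v m = 0" if "m < M \<or> m \<ge> N" for m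
      using that x(1)[of m] by (auto simp: v_def w_def column_zero_iff square_def)
    have nv: "(norm v)\<^sup>2 \<le> 1"
      using norm_proj_le[of "square N" w] w by (simp add: v_def power_le_one)
    have "(norm (z + v))\<^sup>2 = (norm z)\<^sup>2 + (norm v)\<^sup>2"
      by (rule norm_add_disjoint_columns) (metis z(1) v0 not_less)
    then have "(norm (z + v))\<^sup>2 \<le> real (Suc K)" using z(2) nv by simp
    moreover have "real (Suc K) * e \<le> blinfun_apply f (z + v)"
      using z(3) fv by (simp add: blinfun.add_right algebra_simps)
    moreover have "\<forall>m\<ge>N. l2_nth (z + v) m = 0"
      using z(1) v0 N(2) by (auto simp: plus_l2_sum.rep_eq)
    ultimately show ?case by blast
  qed
  note claim = this
  obtain K :: nat where K: "(norm f / e)\<^sup>2 < real K" using reals_Archimedean2 by blast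
  then have K0: "real K > 0" by (smt (verit) zero_le_power2)
  obtain z where z: "(norm z)\<^sup>2 \<le> real K" "real K * e \<le> blinfun_apply f z" using claim by blast
  have "real K * e \<le> norm f * norm z" using z(2) norm_blinfun[of f z] by simp
  then have "(real K * e)\<^sup>2 \<le> (norm f * norm z)\<^sup>2" using K0 e by (intro power_mono) auto
  also have "\<dots> \<le> (norm f)\<^sup>2 * real K"
    using z(1) by (simp add: power_mult_distrib mult_left_mono)
  finally have "real K * (real K * e\<^sup>2) \<le> real K * (norm f)\<^sup>2"
    by (simp add: power2_eq_square algebra_simps)
  then have "real K * e\<^sup>2 \<le> (norm f)\<^sup>2" using K0 by simp
  then show False using K e by (simp add: power_divide divide_less_eq)
qed

lemma norm_first_columns_le:
  "norm (proj ({..<M} \<times> UNIV) x) \<le> (\<Sum>m<M. norm (l2_nth x m))"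
proof -
  let ?y = "proj ({..<M} \<times> UNIV) x"
  have "(norm ?y)\<^sup>2 = (\<Sum>m<M. (norm (l2_nth ?y m))\<^sup>2)"
    unfolding norm_eq_column_norms by (rule suminf_finite) (auto simp: column_norm)
  also have "\<dots> = (\<Sum>m<M. (norm (l2_nth x m))\<^sup>2)"
    by (intro sum.cong) (auto simp: column_norm)
  finally have "norm ?y = L2_set (\<lambda>m. norm (l2_nth x m)) {..<M}"
    unfolding L2_set_def by (metis norm_ge_zero real_sqrt_unique)
  then show ?thesis by (simp add: L2_set_le_sum)
qed

lemma norm_column_proj: "norm (l2_nth x m) = norm (proj ({m} \<times> UNIV) x)"
  by (subst norm_single_column[of m]) (auto simp: column_norm)

text \<open>Beyond some column \<open>M\<close> the functional is small relative to the norm bound,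
  and the first \<open>M\<close> columns together tend to \<open>0\<close> in norm.\<close>

lemma weakly_null_if_columns_null:
  fixes f :: "ell1 l2_sum \<Rightarrow>\<^sub>L real"
  assumes B: "\<And>n. norm (y n) \<le> B" and col: "\<And>m. (\<lambda>n. norm (l2_nth (y n) m)) \<longlonglongrightarrow> 0"
  shows "(\<lambda>n. blinfun_apply f (y n)) \<longlonglongrightarrow> (0::real)"
proof (rule LIMSEQ_I)
  fix e :: real assume "0 < e"
  have B0: "B \<ge> 0" by (rule order_trans[OF norm_ge_zero B[of 0]])
  \<comment> \<open>\<open>B + 1\<close> keeps the denominator positive even if
    \<open>B = 0\<close>.\<close>
  then have "e / (2 * (B + 1)) > 0" using \<open>0 < e\<close> by simp
  then obtain M where M: "\<And>x. (\<forall>m<M. l2_nth x m = 0) \<Longrightarrow> \<bar>blinfun_apply f x\<bar> \<le> e / (2 * (B + 1)) * norm x"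
    using functional_column_decay[of "e / (2 * (B + 1))" f] by auto
  have "(\<lambda>n. norm f * (\<Sum>m<M. norm (l2_nth (y n) m))) \<longlonglongrightarrow> 0"
    by (intro tendsto_mult_right_zero tendsto_null_sum col)
  then have "\<forall>\<^sub>F n in sequentially. norm f * (\<Sum>m<M. norm (l2_nth (y n) m)) < e / 2"
    using \<open>0 < e\<close> by (intro order_tendstoD(2)) auto
  moreover have "norm (blinfun_apply f (y n) - 0) < e" if n: "norm f * (\<Sum>m<M. norm (l2_nth (y n) m)) < e / 2" for n
  proof -
    let ?A = "{..<M} \<times> (UNIV :: nat set)"
    have "\<bar>blinfun_apply f (proj ?A (y n))\<bar> < e / 2"
      using abs_functional_le[OF norm_first_columns_le[of M "y n"], of f] n by linarith
    moreover have "\<bar>blinfun_apply f (proj (- ?A) (y n))\<bar> \<le> e / (2 * (B + 1)) * norm (proj (- ?A) (y n))"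
      by (rule M) (auto simp: column_zero_iff)
    moreover have "e / (2 * (B + 1)) * norm (proj (- ?A) (y n)) \<le> e / (2 * (B + 1)) * (B + 1)"
      using norm_proj_le[of "- ?A" "y n"] B[of n] B0 \<open>0 < e\<close> by (intro mult_left_mono) auto
    moreover have "e / (2 * (B + 1)) * (B + 1) = e / 2" using B0 by (simp add: field_simps)
    moreover have "y n = proj ?A (y n) + proj (- ?A) (y n)" by (rule coord_eqI) auto
    then have "blinfun_apply f (y n) = blinfun_apply f (proj ?A (y n)) + blinfun_apply f (proj (- ?A) (y n))"
      by (metis blinfun.add_right)
    ultimately have "\<bar>blinfun_apply f (y n)\<bar> < e" by linarith
    then show ?thesis by simp
  qed
  ultimately show "\<exists>no. \<forall>n\<ge>no. norm (blinfun_apply f (y n) - 0) < e"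
    by (auto simp: eventually_sequentially)
qed

text \<open>Uniformly small tails upgrade coordinatewise convergence to norm convergence in each
  single column; the decay of functionals takes care of the columns jointly.\<close>

lemma weak_convergence_criterion:
  assumes lim: "\<And>q. (\<lambda>n. coord (x n) q) \<longlonglongrightarrow> coord y q" and B: "\<And>n. norm (x n) \<le> B"
    and tail: "\<And>m e. e > 0 \<Longrightarrow> \<exists>K. \<forall>\<^sub>F n in sequentially. norm (proj ({m} \<times> {K..}) (x n)) \<le> e"
  shows "(\<lambda>n. blinfun_apply f (x n)) \<longlonglongrightarrow> (blinfun_apply f y :: real)"
proof -
  have "(\<lambda>n. blinfun_apply f (x n - y)) \<longlonglongrightarrow> 0"
  proof (rule weakly_null_if_columns_null)
    have "norm y \<le> B" using norm_limit[OF lim] B by auto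
    then show "norm (x n - y) \<le> B + B" for n
      using B[of n] norm_triangle_ineq4[of "x n" y] by linarith
    fix m
    show "(\<lambda>n. norm (l2_nth (x n - y) m)) \<longlonglongrightarrow> 0"
    proof (rule LIMSEQ_I)
      fix e :: real assume "0 < e"
      then obtain K where K: "\<forall>\<^sub>F n in sequentially. norm (proj ({m} \<times> {K..}) (x n)) \<le> e / 3"
        using tail[of "e / 3" m] by auto
      \<comment> \<open>The limit inherits the tail bound by lower semicontinuity of the
        norm.\<close>
      have "norm (proj ({m} \<times> {K..}) y) \<le> e / 3"
        by (rule norm_limit[OF _ K]) (auto simp: lim)
      note yK = this
      have "(\<lambda>n. norm (proj ({m} \<times> {..<K}) (x n - y))) \<longlonglongrightarrow> 0"
        using lim by (intro proj_finite_tendsto_0) (auto simp: LIM_zero_iff)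
      then have "\<forall>\<^sub>F n in sequentially. norm (proj ({m} \<times> {..<K}) (x n - y)) < e / 3"
        using \<open>0 < e\<close> by (intro order_tendstoD(2)) auto
      with K have "\<forall>\<^sub>F n in sequentially. norm (norm (l2_nth (x n - y) m) - 0) < e"
      proof eventually_elim
        case (elim n)
        have "proj ({m} \<times> UNIV) (x n - y)
            = proj ({m} \<times> {..<K}) (x n - y) + (proj ({m} \<times> {K..}) (x n) - proj ({m} \<times> {K..}) y)"
          by (rule coord_eqI) auto
        also have "norm \<dots> \<le> norm (proj ({m} \<times> {..<K}) (x n - y))
            + (norm (proj ({m} \<times> {K..}) (x n)) + norm (proj ({m} \<times> {K..}) y))"
          by (intro norm_triangle_mono norm_triangle_ineq4 order_refl)
        finally show ?case using elim yK by (simp add: norm_column_proj)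
      qed
      then show "\<exists>no. \<forall>n\<ge>no. norm (norm (l2_nth (x n - y) m) - 0) < e"
        by (simp add: eventually_sequentially)
    qed
  qed
  then show ?thesis by (simp add: blinfun.diff_right LIM_zero_iff)
qed

section \<open>Weakly compact sets\<close>

text \<open>The sign pattern is chosen block by block from the terms of the gliding hump subsequence.\<close>

lemma schur_single_column:
  fixes z :: "nat \<Rightarrow> ell1 l2_sum"
  assumes supp: "\<And>k m' i. m' \<noteq> m \<Longrightarrow> coord (z k) (m', i) = 0"
    and weak: "\<And>f. (\<lambda>k. blinfun_apply f (z k)) \<longlonglongrightarrow> (0::real)"
    and d: "d > 0" "\<And>k. d \<le> norm (z k)"
  shows False
proof -
  have z: "(\<lambda>k. coord (z k) q) \<longlonglongrightarrow> 0" for q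
  proof -
    obtain f :: "ell1 l2_sum \<Rightarrow>\<^sub>L real" where "\<And>x. blinfun_apply f x = coord x q"
      using coord_functional[of q] by auto
    then show ?thesis using weak[of f] by simp
  qed
  obtain r N where r: "strict_mono r" and N: "strict_mono N"
    and rN: "\<And>k::nat. norm (proj (- (square (N (Suc k)) - square (N k))) (z (r k))) \<le> d / 4"
    using gliding_hump[OF z, of "d / 4"] d by auto
  define B where "B k = square (N (Suc k)) - square (N k)" for k
  have uniq: "(SOME k. q \<in> B k) = j" if "q \<in> B j" for q j
  proof (rule some_equality)
    fix k assume "q \<in> B k"
    then show "k = j" using blocks_disjoint[OF N, of q k j] that by (simp add: B_def)
  qed (rule that)
  \<comment> \<open>Off the blocks \<open>SOME\<close> yields an arbitrary index; there only
    \<open>\<bar>s q\<bar> \<le> 1\<close> matters.\<close>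
  define s where "s q = sgn (coord (z (r (SOME k. q \<in> B k))) q)" for q
  have s: "\<bar>s q\<bar> \<le> 1" for q by (simp add: s_def abs_sgn_eq)
  \<comment> \<open>The block carries at least \<open>3 * d / 4\<close> of the norm, all of it
    collected by the signs, and the remainder costs at most \<open>d / 4\<close>.\<close>
  have low: "d / 2 \<le> blinfun_apply (signed_column_sum m s) (z (r k))" for k
  proof -
    let ?x = "z (r k)" and ?f = "signed_column_sum m s"
    have split: "?x = proj (B k) ?x + proj (- B k) ?x" by (rule coord_eqI) simp
    have tail: "norm (proj (- B k) ?x) \<le> d / 4" using rN[of k] by (simp add: B_def)
    have "blinfun_apply ?f (proj (B k) ?x) = (\<Sum>i. \<bar>coord (proj (B k) ?x) (m, i)\<bar>)"
      unfolding signed_column_sum(1)[OF s]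
      by (intro suminf_cong) (auto simp: s_def uniq abs_sgn mult.commute)
    also have "\<dots> = norm (proj (B k) ?x)"
      by (rule norm_single_column[symmetric]) (simp add: supp)
    finally have head: "blinfun_apply ?f (proj (B k) ?x) = norm (proj (B k) ?x)" .
    have "norm ?x \<le> norm (proj (B k) ?x) + norm (proj (- B k) ?x)"
      using norm_triangle_ineq[of "proj (B k) ?x" "proj (- B k) ?x"] by (simp only: split[symmetric])
    moreover have "blinfun_apply ?f ?x = blinfun_apply ?f (proj (B k) ?x) + blinfun_apply ?f (proj (- B k) ?x)"
      using blinfun.add_right[of ?f "proj (B k) ?x" "proj (- B k) ?x"] by (simp only: split[symmetric])
    moreover have "\<bar>blinfun_apply ?f (proj (- B k) ?x)\<bar> \<le> norm (proj (- B k) ?x)"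
      by (rule signed_column_sum(2)[OF s])
    ultimately show ?thesis using head tail d(2)[of "r k"] by linarith
  qed
  have "(\<lambda>k. blinfun_apply (signed_column_sum m s) (z (r k))) \<longlonglongrightarrow> 0"
    using LIMSEQ_subseq_LIMSEQ[OF weak r] by (simp add: comp_def)
  then have "d / 2 \<le> 0" by (rule LIMSEQ_le_const) (use low in blast)
  then show False using d by simp
qed

lemma continuous_map_coord: "continuous_map weak_topology euclidean coord"
proof -
  have "continuous_map weak_topology euclidean (\<lambda>x. coord x q)" for q
  proof -
    obtain f :: "ell1 l2_sum \<Rightarrow>\<^sub>L real" where "\<And>x. blinfun_apply f x = coord x q"
      using coord_functional[of q] by auto
    then have "blinfun_apply f = (\<lambda>x. coord x q)" by (rule ext)
    then show ?thesis using continuous_map_weak_functional[of f] by simp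
  qed
  then show ?thesis
    by (simp add: euclidean_product_topology[symmetric] continuous_map_componentwise_UNIV)
qed

lemma tendsto_fun_iff:
  fixes l :: "'i \<Rightarrow> 'b::topological_space"
  shows "(f \<longlongrightarrow> l) F \<longleftrightarrow> (\<forall>i. ((\<lambda>n. f n i) \<longlongrightarrow> l i) F)"
proof -
  have "limitin (product_topology (\<lambda>i. euclidean) UNIV) f l F \<longleftrightarrow> (\<forall>i. limitin euclidean (\<lambda>n. f n i) (l i) F)"
    by (simp only: limitin_componentwise) auto
  then show ?thesis by (simp add: euclidean_product_topology)
qed

text \<open>On a weakly compact set the weak topology is that of coordinatewise convergence, which is
  metrizable.\<close>

lemma weakly_compact_subsequence:
  assumes L: "weakly_compact L" and x: "\<And>k. x k \<in> L"
  shows "\<exists>y\<in>L. \<exists>r. strict_mono (r :: nat \<Rightarrow> nat) \<and>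
    (\<forall>f :: ell1 l2_sum \<Rightarrow>\<^sub>L real. (\<lambda>k. blinfun_apply f (x (r k))) \<longlonglongrightarrow> blinfun_apply f y)"
proof -
  let ?T = "subtopology weak_topology L" and ?U = "top_of_set (coord ` L)"
  \<comment> \<open>A continuous injection from a compact space into a Hausdorff space is a
    homeomorphism onto its image. Its inverse turns functionals into continuous functions of the
    coordinates.\<close>
  have "homeomorphic_map ?T ?U coord"
  proof (rule continuous_imp_homeomorphic_map)
    show "continuous_map ?T ?U coord"
      by (rule continuous_map_into_subtopology)
        (auto intro: continuous_map_from_subtopology continuous_map_coord)
    show "compact_space ?T" using L by (rule compact_space_subtopology)
    show "Hausdorff_space ?U" by (simp add: Hausdorff_space_subtopology)
    show "inj_on coord (topspace ?T)" by (auto intro!: inj_onI coord_eqI)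
  qed auto
  then obtain g where g: "continuous_map ?U ?T g" "\<And>x. x \<in> L \<Longrightarrow> g (coord x) = x"
    by (auto simp: homeomorphic_map_maps homeomorphic_maps_def)
  have "compact (coord ` L)"
    using image_compactin[OF L continuous_map_coord] by simp
  then have "seq_compact (coord ` L)" by (rule compact_imp_seq_compact)
  moreover have "\<forall>k. coord (x k) \<in> coord ` L" using x by blast
  ultimately obtain c r where "c \<in> coord ` L" and r: "strict_mono (r :: nat \<Rightarrow> nat)"
    and "((\<lambda>k. coord (x k)) \<circ> r) \<longlonglongrightarrow> c"
    by (rule seq_compactE)
  then obtain y where y: "y \<in> L" and lim: "(\<lambda>k. coord (x (r k))) \<longlonglongrightarrow> coord y"
    by (auto simp: comp_def)
  have "(\<lambda>k. blinfun_apply f (x (r k))) \<longlonglongrightarrow> blinfun_apply f y" for f :: "ell1 l2_sum \<Rightarrow>\<^sub>L real"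
  proof -
    have "continuous_map ?U euclidean (blinfun_apply f \<circ> g)"
      using g(1) by (intro continuous_map_compose[OF _ continuous_map_weak_functional])
        (auto simp: continuous_map_in_subtopology)
    then have "continuous_on (coord ` L) (blinfun_apply f \<circ> g)" by simp
    then have "(\<lambda>k. (blinfun_apply f \<circ> g) (coord (x (r k)))) \<longlonglongrightarrow> (blinfun_apply f \<circ> g) (coord y)"
      by (rule continuous_on_tendsto_compose[OF _ lim]) (use x y in auto)
    then show ?thesis using g(2) x y by simp
  qed
  with y r show ?thesis by blast
qed

lemma proj_tail_eventually_small:
  assumes "e > 0"
  shows "\<forall>\<^sub>F K in sequentially. norm (proj ({m} \<times> {K..}) y) < e"
proof -
  have "norm (proj ({m} \<times> {K..}) y) \<le> norm (proj (- square K) y)" for K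
    by (rule norm_proj_mono) (auto simp: square_def)
  moreover have "\<forall>\<^sub>F K in sequentially. norm (proj (- square K) y) < e"
    using assms by (intro order_tendstoD(2)[OF proj_square_tail]) auto
  ultimately show ?thesis by (auto elim!: eventually_mono intro: le_less_trans)
qed

text \<open>Vectors violating the bound for every \<open>K\<close> would have a weakly convergent
  subsequence. Restricted to the column, the differences from its limit are weakly null but bounded
  away from \<open>0\<close> in norm, which Schur's argument excludes.\<close>

lemma weakly_compact_uniform_tails:
  assumes L: "weakly_compact L" and e: "e > 0"
  shows "\<exists>K. \<forall>x\<in>L. norm (proj ({m} \<times> {K..}) x) \<le> e"
proof (rule ccontr)
  assume "\<not> ?thesis"
  then have "\<forall>K. \<exists>x\<in>L. e < norm (proj ({m} \<times> {K..}) x)" by (meson not_less)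
  then obtain x where x: "\<And>K. x K \<in> L" "\<And>K. e < norm (proj ({m} \<times> {K..}) (x K))" by metis
  obtain y r where r: "strict_mono (r :: nat \<Rightarrow> nat)"
    and weak: "\<And>f :: ell1 l2_sum \<Rightarrow>\<^sub>L real. (\<lambda>k. blinfun_apply f (x (r k))) \<longlonglongrightarrow> blinfun_apply f y"
    using weakly_compact_subsequence[OF L, of x] x(1) by blast
  obtain n where n: "\<And>K. K \<ge> n \<Longrightarrow> norm (proj ({m} \<times> {K..}) y) < e / 2"
    using proj_tail_eventually_small[of "e / 2" m y] e by (auto simp: eventually_sequentially)
  \<comment> \<open>The shift by \<open>n\<close> makes the tail of \<open>y\<close> smaller than
    \<open>e / 2\<close> at every index that occurs.\<close>
  define z where "z k = proj ({m} \<times> UNIV) (x (r (k + n)) - y)" for k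
  show False
  proof (rule schur_single_column)
    show "coord (z k) (m', i) = 0" if "m' \<noteq> m" for k m' i
      using that by (simp add: z_def)
    show "e / 2 > 0" using e by simp
    show "(\<lambda>k. blinfun_apply f (z k)) \<longlonglongrightarrow> 0" for f :: "ell1 l2_sum \<Rightarrow>\<^sub>L real"
    proof -
      define g where "g = f o\<^sub>L Blinfun (proj ({m} \<times> UNIV))"
      have g: "blinfun_apply g u = blinfun_apply f (proj ({m} \<times> UNIV) u)" for u
        by (simp add: g_def bounded_linear_Blinfun_apply bounded_linear_proj)
      have "(\<lambda>k. blinfun_apply g (x (r k)) - blinfun_apply g y) \<longlonglongrightarrow> 0"
        using weak[of g] by (rule LIM_zero)
      then have "(\<lambda>k. blinfun_apply g (x (r (k + n))) - blinfun_apply g y) \<longlonglongrightarrow> 0"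
        by (rule LIMSEQ_ignore_initial_segment)
      then show ?thesis by (simp add: z_def g[symmetric] blinfun.diff_right)
    qed
    show "e / 2 \<le> norm (z k)" for k
    proof -
      let ?K = "r (k + n)"
      have "n \<le> ?K" using seq_suble[OF r, of "k + n"] by simp
      then have "norm (proj ({m} \<times> {?K..}) y) < e / 2" by (rule n)
      moreover have "e < norm (proj ({m} \<times> {?K..}) (x ?K))" by (rule x(2))
      moreover have "norm (proj ({m} \<times> {?K..}) (x ?K)) - norm (proj ({m} \<times> {?K..}) y)
          \<le> norm (proj ({m} \<times> {?K..}) (x ?K - y))"
        unfolding proj_diff by (rule norm_triangle_ineq2)
      moreover have "norm (proj ({m} \<times> {?K..}) (x ?K - y)) \<le> norm (z k)"
        unfolding z_def by (rule norm_proj_mono) auto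
      ultimately show ?thesis by linarith
    qed
  qed
qed

text \<open>These are the values of the usco map. Each bound reads a single entry of \<sigma>, so
  sequences agreeing on a long initial segment share many bounds; the \<open>Suc\<close> reserves
  entry \<open>0\<close> for the norm.\<close>

definition tail_bounded_set :: "(nat \<Rightarrow> nat) \<Rightarrow> (ell1 l2_sum) set" where
  "tail_bounded_set \<sigma> = {x. norm x \<le> real (\<sigma> 0) \<and>
     (\<forall>m p. norm (proj ({m} \<times> {\<sigma> (Suc (prod_encode (m, p)))..}) x) \<le> 1 / (real p + 1))}"

text \<open>This is shared by weak compactness and upper semicontinuity. In the latter the
  \<open>n\<close>-th vector obeys the tail bounds of a sequence that varies with \<open>n\<close>,
  so each bound of \<sigma> holds only eventually.\<close>

lemma tail_bounded_limit:
  assumes lim: "\<And>q. (\<lambda>n. coord (x n) q) \<longlonglongrightarrow> coord y q" and B: "\<And>n. norm (x n) \<le> real (\<sigma> 0)"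
    and tail: "\<And>m p. \<forall>\<^sub>F n in sequentially.
      norm (proj ({m} \<times> {\<sigma> (Suc (prod_encode (m, p)))..}) (x n)) \<le> 1 / (real p + 1)"
  shows "y \<in> tail_bounded_set \<sigma>"
    and "(\<lambda>n. blinfun_apply f (x n)) \<longlonglongrightarrow> (blinfun_apply f y :: real)"
proof -
  have "norm y \<le> real (\<sigma> 0)" using norm_limit[OF lim] B by auto
  moreover have "norm (proj ({m} \<times> {\<sigma> (Suc (prod_encode (m, p)))..}) y) \<le> 1 / (real p + 1)" for m p
    by (rule norm_limit[OF _ tail[of m p]]) (simp add: lim)
  ultimately show "y \<in> tail_bounded_set \<sigma>" by (simp add: tail_bounded_set_def)
  show "(\<lambda>n. blinfun_apply f (x n)) \<longlonglongrightarrow> blinfun_apply f y"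
  proof (rule weak_convergence_criterion[OF lim B])
    fix m and e :: real assume "e > 0"
    then obtain p where p: "1 / (real p + 1) < e"
      using nat_approx_posE[of e] by (auto simp: add.commute)
    show "\<exists>K. \<forall>\<^sub>F n in sequentially. norm (proj ({m} \<times> {K..}) (x n)) \<le> e"
      using tail[of m p] p
      by (intro exI[of _ "\<sigma> (Suc (prod_encode (m, p)))"]) (auto elim!: eventually_mono)
  qed
qed

text \<open>All entries lie in a bounded interval, a countable product of such intervals is compact
  and metrizable, and the norm bound turns the limiting family into a vector.\<close>

lemma coordinatewise_convergent_subsequence:
  assumes B: "\<And>n. norm (x n) \<le> B"
  shows "\<exists>y r. strict_mono (r :: nat \<Rightarrow> nat) \<and> (\<forall>q. (\<lambda>n. coord (x (r n)) q) \<longlonglongrightarrow> coord y q)"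
proof -
  define K where "K = (\<Pi>\<^sub>E q\<in>(UNIV :: (nat \<times> nat) set). cball (0::real) B)"
  have "compactin euclidean K"
    unfolding K_def euclidean_product_topology[symmetric] compactin_PiE by auto
  then have "seq_compact K" by (simp add: compact_imp_seq_compact)
  moreover have "coord (x n) \<in> K" for n
    using order_trans[OF abs_coord_le_norm B[of n]] by (simp add: K_def PiE_iff)
  ultimately obtain c r where r: "strict_mono (r :: nat \<Rightarrow> nat)" and "((\<lambda>n. coord (x n)) \<circ> r) \<longlonglongrightarrow> c"
    using seq_compactE[of K "\<lambda>n. coord (x n)"] by blast
  then have c: "(\<lambda>n. coord (x (r n)) q) \<longlonglongrightarrow> c q" for q
    unfolding tendsto_fun_iff comp_def by blast
  then obtain y where "coord y = c" using coord_limit[OF c, of B] B by auto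
  with r c show ?thesis by blast
qed

text \<open>The coordinate image is sequentially compact, hence compact. On it the inverse of
  \<open>coord\<close> is continuous into the weak topology, because for these vectors
  coordinatewise convergence implies weak convergence.\<close>

lemma weakly_compact_tail_bounded_set: "weakly_compact (tail_bounded_set \<sigma>)"
proof -
  let ?F = "tail_bounded_set \<sigma>"
  have bounds: "norm x \<le> real (\<sigma> 0)"
    "norm (proj ({m} \<times> {\<sigma> (Suc (prod_encode (m, p)))..}) x) \<le> 1 / (real p + 1)" if "x \<in> ?F" for x m p
    using that by (auto simp: tail_bounded_set_def)
  have seq: "y \<in> ?F" "(\<lambda>n. blinfun_apply f (x n)) \<longlonglongrightarrow> blinfun_apply f y"
    if "\<And>n. x n \<in> ?F" "\<And>q. (\<lambda>n. coord (x n) q) \<longlonglongrightarrow> coord y q" for x y and f :: "ell1 l2_sum \<Rightarrow>\<^sub>L real"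
    using tail_bounded_limit[of x y \<sigma>] that bounds by auto
  have "seq_compact (coord ` ?F)"
    unfolding seq_compact_def
  proof (intro allI impI)
    fix u :: "nat \<Rightarrow> nat \<times> nat \<Rightarrow> real" assume "\<forall>n. u n \<in> coord ` ?F"
    then have "\<exists>x. \<forall>n. x n \<in> ?F \<and> u n = coord (x n)" by (intro choice) auto
    then obtain x where x: "\<And>n. x n \<in> ?F" "\<And>n. u n = coord (x n)" by blast
    obtain y r where r: "strict_mono (r :: nat \<Rightarrow> nat)" and y: "\<And>q. (\<lambda>n. coord (x (r n)) q) \<longlonglongrightarrow> coord y q"
      using coordinatewise_convergent_subsequence[of x "real (\<sigma> 0)"] bounds(1) x(1) by blast
    have "y \<in> ?F" by (rule seq(1)[OF _ y]) (rule x(1))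
    moreover have "(u \<circ> r) \<longlonglongrightarrow> coord y" using y unfolding tendsto_fun_iff comp_def x(2) by blast
    ultimately show "\<exists>l\<in>coord ` ?F. \<exists>r. strict_mono r \<and> (u \<circ> r) \<longlonglongrightarrow> l" using r by blast
  qed
  then have compact: "compactin (top_of_set (coord ` ?F)) (coord ` ?F)"
    by (simp add: compactin_subtopology seq_compact_eq_compact)
  define g where "g = inv_into ?F coord"
  have inj: "inj_on coord ?F" by (auto intro!: inj_onI coord_eqI)
  have g: "g (coord x) = x" if "x \<in> ?F" for x
    unfolding g_def by (rule inv_into_f_f[OF inj that])
  have "continuous_map (top_of_set (coord ` ?F)) weak_topology g"
  proof (rule continuous_map_into_weak)
    fix f :: "ell1 l2_sum \<Rightarrow>\<^sub>L real"
    have "continuous_on (coord ` ?F) (\<lambda>c. blinfun_apply f (g c))"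
      unfolding continuous_on_sequentially
    proof safe
      fix u y assume u: "\<forall>n. u n \<in> coord ` ?F" "u \<longlonglongrightarrow> coord y" and y: "y \<in> ?F"
      have "\<exists>x. \<forall>n. x n \<in> ?F \<and> u n = coord (x n)" using u(1) by (intro choice) auto
      then obtain x where x: "\<And>n. x n \<in> ?F" "\<And>n. u n = coord (x n)" by blast
      have "(\<lambda>n. coord (x n) q) \<longlonglongrightarrow> coord y q" for q
        using u(2) unfolding tendsto_fun_iff x(2) by blast
      from seq(2)[OF x(1) this, of f]
      show "((\<lambda>c. blinfun_apply f (g c)) \<circ> u) \<longlonglongrightarrow> blinfun_apply f (g (coord y))"
        by (simp add: comp_def x g y)
    qed
    then show "continuous_map (top_of_set (coord ` ?F)) euclidean (\<lambda>c. blinfun_apply f (g c))" by simp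
  qed
  from image_compactin[OF compact this] have "weakly_compact (g ` coord ` ?F)" .
  moreover have "g ` coord ` ?F = ?F" using g by (force simp: image_image)
  ultimately show ?thesis by simp
qed

section \<open>Upper semicontinuity and absorption of weakly compact sets\<close>

lemma open_agree_below: "open {\<tau> :: nat \<Rightarrow> nat. \<forall>i<n. \<tau> i = \<sigma> i}"
proof -
  have "open {\<tau> :: nat \<Rightarrow> nat. \<forall>i\<in>{..<n}. \<tau> i \<in> {\<sigma> i}}"
    by (rule product_topology_basis') (simp_all add: open_discrete)
  also have "{\<tau>. \<forall>i\<in>{..<n}. \<tau> i \<in> {\<sigma> i}} = {\<tau>. \<forall>i<n. \<tau> i = \<sigma> i}" by auto
  finally show ?thesis .
qed

text \<open>If no basic neighbourhood of \<sigma> works, points outside \<open>V\<close> come from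
  sequences agreeing with \<sigma> ever longer. A subsequence converges weakly into the value at
  \<sigma>, hence into the open set \<open>V\<close>.\<close>

lemma usco_tail_bounded_set: "usco weak_topology tail_bounded_set"
  unfolding usco_def
proof (intro conjI allI impI; (elim conjE)?)
  have "proj A 0 = 0" for A by (rule coord_eqI) simp
  then have "0 \<in> tail_bounded_set \<sigma>" for \<sigma> by (simp add: tail_bounded_set_def)
  then show "tail_bounded_set \<sigma> \<noteq> {}" for \<sigma> by blast
  show "weakly_compact (tail_bounded_set \<sigma>)" for \<sigma> by (rule weakly_compact_tail_bounded_set)
next
  fix \<sigma> V assume V: "openin weak_topology V" "tail_bounded_set \<sigma> \<subseteq> V"
  have "\<exists>n. (\<Union>\<tau>\<in>{\<tau>. \<forall>i<n. \<tau> i = \<sigma> i}. tail_bounded_set \<tau>) \<subseteq> V"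
  proof (rule ccontr)
    assume "\<not> ?thesis"
    then have "\<forall>n. \<exists>\<tau> x. (\<forall>i<n. \<tau> i = \<sigma> i) \<and> x \<in> tail_bounded_set \<tau> \<and> x \<notin> V" by blast
    then obtain \<tau> x where \<tau>: "\<And>n i. i < n \<Longrightarrow> \<tau> n i = \<sigma> i"
      and x: "\<And>n. x n \<in> tail_bounded_set (\<tau> n)" "\<And>n. x n \<notin> V" by metis
    \<comment> \<open>The shift to \<open>Suc n\<close> is needed because \<open>\<tau> 0\<close>
      need not agree with \<sigma> even at entry \<open>0\<close>, which bounds the norm.\<close>
    have B: "norm (x (Suc n)) \<le> real (\<sigma> 0)" for n
      using x(1)[of "Suc n"] \<tau>[of 0 "Suc n"] by (simp add: tail_bounded_set_def)
    obtain y r where r: "strict_mono (r :: nat \<Rightarrow> nat)"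
      and y: "\<And>q. (\<lambda>n. coord (x (Suc (r n))) q) \<longlonglongrightarrow> coord y q"
      using coordinatewise_convergent_subsequence[of "\<lambda>n. x (Suc n)", OF B] by blast
    have tail: "\<forall>\<^sub>F n in sequentially.
        norm (proj ({m} \<times> {\<sigma> (Suc (prod_encode (m, p)))..}) (x (Suc (r n)))) \<le> 1 / (real p + 1)" for m p
      using eventually_gt_at_top[of "prod_encode (m, p)"]
    proof eventually_elim
      case (elim n)
      then have "Suc (prod_encode (m, p)) < Suc (r n)" using seq_suble[OF r, of n] by simp
      from \<tau>[OF this] have "\<tau> (Suc (r n)) (Suc (prod_encode (m, p))) = \<sigma> (Suc (prod_encode (m, p)))" .
      moreover have "norm (proj ({m} \<times> {\<tau> (Suc (r n)) (Suc (prod_encode (m, p)))..}) (x (Suc (r n))))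
          \<le> 1 / (real p + 1)"
        using x(1)[of "Suc (r n)"] by (simp add: tail_bounded_set_def)
      ultimately show ?case by simp
    qed
    have "y \<in> V" using tail_bounded_limit(1)[OF y B tail] V by blast
    moreover have "limitin weak_topology (\<lambda>n. x (Suc (r n))) y sequentially"
      by (rule limitin_weak_topology) (rule tail_bounded_limit(2)[OF y B tail])
    ultimately have "\<forall>\<^sub>F n in sequentially. x (Suc (r n)) \<in> V" using V by (auto simp: limitin_def)
    then show False using x(2) by simp
  qed
  then obtain n where "(\<Union>\<tau>\<in>{\<tau>. \<forall>i<n. \<tau> i = \<sigma> i}. tail_bounded_set \<tau>) \<subseteq> V" ..
  then show "\<exists>W. open W \<and> \<sigma> \<in> W \<and> (\<Union>\<tau>\<in>W. tail_bounded_set \<tau>) \<subseteq> V"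
    by (intro exI[of _ "{\<tau>. \<forall>i<n. \<tau> i = \<sigma> i}"]) (simp add: open_agree_below)
qed

text \<open>Boundedness supplies the entry \<open>0\<close> and the uniform tails supply all
  others.\<close>

lemma tail_bounded_set_absorbs:
  assumes L: "weakly_compact L"
  shows "\<exists>\<sigma>. L \<subseteq> tail_bounded_set \<sigma>"
proof -
  obtain B where B: "\<And>x. x \<in> L \<Longrightarrow> norm x \<le> B"
    using weakly_compact_imp_bounded[OF L] by (auto simp: bounded_iff)
  have "\<exists>K. \<forall>x\<in>L. norm (proj ({m} \<times> {K..}) x) \<le> 1 / (real p + 1)" for m p
    by (rule weakly_compact_uniform_tails[OF L]) simp
  then obtain K where K: "\<And>m p x. x \<in> L \<Longrightarrow> norm (proj ({m} \<times> {K m p..}) x) \<le> 1 / (real p + 1)"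
    by metis
  define \<sigma> where "\<sigma> k = (case k of 0 \<Rightarrow> nat \<lceil>B\<rceil> | Suc l \<Rightarrow> case_prod K (prod_decode l))" for k
  have "norm x \<le> real (\<sigma> 0)" if "x \<in> L" for x
    using B[OF that] real_nat_ceiling_ge[of B] by (simp add: \<sigma>_def)
  then have "L \<subseteq> tail_bounded_set \<sigma>"
    using K by (auto simp: tail_bounded_set_def \<sigma>_def)
  then show ?thesis by blast
qed

lemma SWKA_l2_sum_ell1: "SWKA TYPE(ell1 l2_sum)"
  unfolding SWKA_def strongly_K_analytic_def
proof (intro exI[of _ tail_bounded_set] conjI allI impI)
  have "\<exists>\<sigma>. x \<in> tail_bounded_set \<sigma>" for x
  proof -
    have "weakly_compact {x}" by simp
    then show ?thesis using tail_bounded_set_absorbs by blast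
  qed
  then show "(\<Union>\<sigma>. tail_bounded_set \<sigma>) = topspace weak_topology" by auto
qed (auto intro: usco_tail_bounded_set tail_bounded_set_absorbs)

section \<open>Negative results by diagonalisation\<close>

text \<open>Diagonalisation: the set \<open>L\<close> contains one unit vector outside \<open>G m\<close> in each column \<open>m\<close>.\<close>

lemma weakly_compact_not_absorbed:
  fixes G :: "nat \<Rightarrow> (ell1 l2_sum) set"
  assumes fin: "\<And>n m. finite {i. unit_vec (m, i) \<in> G n}"
  shows "\<exists>L. weakly_compact L \<and> (\<forall>n. \<not> L \<subseteq> G n)"
proof -
  have "\<exists>i. unit_vec (m, i) \<notin> G m" for m
    using ex_new_if_finite[OF infinite_UNIV_nat fin[of m m]] by auto
  then obtain \<phi> where \<phi>: "\<And>m. unit_vec (m, \<phi> m) \<notin> G m" by metis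
  \<comment> \<open>In column \<open>m\<close> all selected vectors vanish from
    \<open>Suc (\<phi> m)\<close> on, so one entry serves every accuracy \<open>p\<close>.\<close>
  define \<sigma> where "\<sigma> k = (case k of 0 \<Rightarrow> 1 | Suc l \<Rightarrow> Suc (\<phi> (fst (prod_decode l))))" for k
  have "unit_vec (m, \<phi> m) \<in> tail_bounded_set \<sigma>" for m
  proof -
    have "proj ({m'} \<times> {Suc (\<phi> m')..}) (unit_vec (m, \<phi> m)) = 0" for m'
      by (rule coord_eqI) (auto simp: unit_vec(1) indicator_def)
    then show ?thesis
      using unit_vec(2) by (simp add: tail_bounded_set_def \<sigma>_def)
  qed
  then have "\<not> tail_bounded_set \<sigma> \<subseteq> G n" for n using \<phi> by blast
  then show ?thesis using weakly_compact_tail_bounded_set by blast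
qed

text \<open>It separates far unit vectors of the column, where its value is \<open>1\<close>, from
  any fixed vector, where its value tends to \<open>0\<close> as \<open>K\<close> grows.\<close>

definition column_tail_sum :: "nat \<Rightarrow> nat \<Rightarrow> ell1 l2_sum \<Rightarrow>\<^sub>L real" where
  "column_tail_sum m K = signed_column_sum m (indicator ({m} \<times> {K..}))"

lemma column_tail_sum:
  shows "norm (column_tail_sum m K) \<le> 1"
    and "\<bar>blinfun_apply (column_tail_sum m K) x\<bar> \<le> norm (proj ({m} \<times> {K..}) x)"
    and "K \<le> i \<Longrightarrow> blinfun_apply (column_tail_sum m K) (unit_vec (m, i)) = 1"
proof -
  have s: "\<bar>indicat_real ({m} \<times> {K..}) q\<bar> \<le> 1" for q by (simp add: indicator_def)
  show "norm (column_tail_sum m K) \<le> 1"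
    unfolding column_tail_sum_def by (rule signed_column_sum(3)[OF s])
  have "blinfun_apply (column_tail_sum m K) x = blinfun_apply (column_tail_sum m K) (proj ({m} \<times> {K..}) x)"
    unfolding column_tail_sum_def signed_column_sum(1)[OF s]
    by (intro suminf_cong) (auto simp: indicator_def)
  also have "\<bar>\<dots>\<bar> \<le> norm (proj ({m} \<times> {K..}) x)"
    unfolding column_tail_sum_def by (rule signed_column_sum(2)[OF s])
  finally show "\<bar>blinfun_apply (column_tail_sum m K) x\<bar> \<le> norm (proj ({m} \<times> {K..}) x)" .
  assume "K \<le> i"
  then have "blinfun_apply (column_tail_sum m K) (unit_vec (m, i)) = (\<Sum>j\<in>{i}. 1)"
    unfolding column_tail_sum_def signed_column_sum(1)[OF s] unit_vec(1)
    by (subst suminf_finite[of "{i}"]) (auto simp: indicator_def)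
  then show "blinfun_apply (column_tail_sum m K) (unit_vec (m, i)) = 1" by simp
qed

text \<open>A weak-star cluster point of infinitely many unit vectors of one column takes the value \<open>1\<close> on
  all tail sums, hence has distance at least \<open>1\<close> from the space.\<close>

lemma eps_weakly_relatively_compact_unit_vecs:
  assumes M: "eps_weakly_relatively_compact \<epsilon> M" and \<epsilon>: "\<epsilon> < 1"
  shows "finite {i. unit_vec (m, i) \<in> M}"
proof (rule ccontr)
  assume inf: "infinite {i. unit_vec (m, i) \<in> M}"
  define e where "e = enumerate {i. unit_vec (m, i) \<in> M}"
  have e: "unit_vec (m, e k) \<in> M" "k \<le> e k" for k
    using enumerate_in_set[OF inf, of k] le_enumerate[OF inf, of k] by (auto simp: e_def)
  have le_e: "l \<le> e k" if "l \<le> k" for l k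
    using e(2)[of k] that by simp
  obtain u where u: "\<And>l. u \<in> weak_star_topology closure_of (bidual_embedding ` (\<lambda>k. unit_vec (m, e k)) ` {l..})"
    using weak_star_cluster_point[of "\<lambda>k. unit_vec (m, e k)" 1] unit_vec(2) by blast
  \<comment> \<open>Evaluation at a functional is weak-star continuous, so the value
    \<open>1\<close> on a tail of the sequence passes to \<open>u\<close>.\<close>
  have val: "blinfun_apply u (column_tail_sum m l) = 1" for l
  proof -
    let ?C = "{w \<in> topspace weak_star_topology. blinfun_apply w (column_tail_sum m l) \<in> {1::real}}"
    have "closedin weak_star_topology ?C"
      by (rule closedin_continuous_map_preimage[OF strong_operator_topology_continuous_evaluation]) simp
    moreover have "bidual_embedding ` (\<lambda>k. unit_vec (m, e k)) ` {l..} \<subseteq> ?C"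
      by (auto simp: bidual_embedding.rep_eq strong_operator_topology_topspace le_e column_tail_sum(3))
    ultimately have "u \<in> ?C" using u[of l] closure_of_minimal by blast
    then show ?thesis by simp
  qed
  have "u \<in> weak_star_topology closure_of (bidual_embedding ` M)"
    using u[of 0] by (rule subsetD[OF closure_of_mono, rotated]) (use e(1) in auto)
  then obtain x v where uxv: "u = bidual_embedding x + v" "norm v \<le> \<epsilon>"
    using M by (auto simp: eps_weakly_relatively_compact_def)
  \<comment> \<open>Beyond \<open>l\<close> the part \<open>x\<close> contributes less than
    \<open>1 - \<epsilon>\<close> and \<open>v\<close> at most \<epsilon>, too little for the value
    \<open>1\<close>.\<close>
  obtain l where l: "norm (proj ({m} \<times> {l..}) x) < 1 - \<epsilon>"
    using proj_tail_eventually_small[of "1 - \<epsilon>" m x] \<epsilon> by (auto simp: eventually_sequentially)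
  have "1 = blinfun_apply (column_tail_sum m l) x + blinfun_apply v (column_tail_sum m l)"
    using val[of l] by (simp add: uxv(1) blinfun.add_left bidual_embedding.rep_eq)
  moreover have "\<bar>blinfun_apply (column_tail_sum m l) x\<bar> < 1 - \<epsilon>"
    using column_tail_sum(2) l le_less_trans by blast
  moreover have "\<bar>blinfun_apply v (column_tail_sum m l)\<bar> \<le> \<epsilon>"
    using abs_functional_le[OF column_tail_sum(1), of v m l] uxv(2) by simp
  ultimately show False by linarith
qed

lemma not_property_star_l2_sum_ell1: "\<not> property_star TYPE(ell1 l2_sum)"
proof
  assume "property_star TYPE(ell1 l2_sum)"
  then obtain M :: "nat \<Rightarrow> nat \<Rightarrow> (ell1 l2_sum) set"
    where wrc: "\<forall>n. \<forall>p\<ge>1. eps_weakly_relatively_compact (1 / real p) (M n p)"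
      and abs: "\<forall>p\<ge>1. \<forall>L. weakly_compact L \<longrightarrow> (\<exists>n. L \<subseteq> M n p)"
    unfolding property_star_def by blast
  \<comment> \<open>With \<open>p = 2\<close> the accuracy \<open>1 / 2\<close> lies below the
    critical distance \<open>1\<close>.\<close>
  have "finite {i. unit_vec (m, i) \<in> M n 2}" for m n
    by (rule eps_weakly_relatively_compact_unit_vecs[OF wrc[rule_format]]) auto
  then obtain L where "weakly_compact L" "\<And>n. \<not> L \<subseteq> M n 2"
    using weakly_compact_not_absorbed[of "\<lambda>n. M n 2"] by blast
  then show False using abs[rule_format, of 2 L] by auto
qed

text \<open>If infinitely many images of unit vectors of one column were within \<open>1/4\<close> of \<open>n K\<close>, then by
  Mazur's theorem two convex combinations of them, the second one with far out indices, would be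
  at distance less than \<open>1\<close>, which a tail sum functional excludes.\<close>

lemma unit_vecs_near_weakly_compact:
  fixes j :: "ell1 l2_sum \<Rightarrow> 'z::banach"
  assumes j: "linear j" "\<And>x. norm (j x) = norm x" and K: "weakly_compact K"
  shows "finite {i. j (unit_vec (m, i)) \<in> {real n *\<^sub>R k + u | k u. k \<in> K \<and> u \<in> cball 0 (1 / 4)}}"
    (is "finite ?I")
proof (rule ccontr)
  assume inf: "infinite ?I"
  define e where "e = enumerate ?I"
  have e: "e k \<in> ?I" "k \<le> e k" for k
    using enumerate_in_set[OF inf, of k] le_enumerate[OF inf, of k] by (auto simp: e_def)
  have "\<exists>\<kappa>\<in>K. norm (real n *\<^sub>R \<kappa> - j (unit_vec (m, e k))) \<le> 1 / 4" for k
  proof -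
    obtain \<kappa> u where "j (unit_vec (m, e k)) = real n *\<^sub>R \<kappa> + u" "\<kappa> \<in> K" "norm u \<le> 1 / 4"
      using e(1)[of k] by auto
    then show ?thesis by (intro bexI[of _ \<kappa>]) simp_all
  qed
  then obtain \<kappa> where \<kappa>: "\<And>k. \<kappa> k \<in> K" "\<And>k. norm (real n *\<^sub>R \<kappa> k - j (unit_vec (m, e k))) \<le> 1 / 4"
    by metis
  obtain z where z: "\<And>l. z \<in> weak_topology closure_of (\<kappa> ` {l..})"
    using compactin_cluster_point[OF K, of \<kappa>] \<kappa>(1) by blast
  \<comment> \<open>This convex set contains every \<open>\<kappa> k\<close> with
    \<open>l \<le> k\<close>, hence their convex hull, so the weights of convex combinations need
    not be tracked.\<close>
  define D where "D l = {w. \<exists>v. norm (real n *\<^sub>R w - j v) \<le> 1 / 4 \<and> blinfun_apply (column_tail_sum m l) v = 1}" for l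
  have convex: "convex (D l)" for l
  proof (rule convexI)
    fix w w' and s t :: real assume "w \<in> D l" "w' \<in> D l" and st: "0 \<le> s" "0 \<le> t" "s + t = 1"
    then obtain v v' where v: "norm (real n *\<^sub>R w - j v) \<le> 1 / 4" "blinfun_apply (column_tail_sum m l) v = 1"
      and v': "norm (real n *\<^sub>R w' - j v') \<le> 1 / 4" "blinfun_apply (column_tail_sum m l) v' = 1"
      by (auto simp: D_def)
    have "real n *\<^sub>R (s *\<^sub>R w + t *\<^sub>R w') - j (s *\<^sub>R v + t *\<^sub>R v')
        = s *\<^sub>R (real n *\<^sub>R w - j v) + t *\<^sub>R (real n *\<^sub>R w' - j v')"
      by (simp add: linear_add[OF j(1)] linear_scale[OF j(1)] algebra_simps)
    also have "norm \<dots> \<le> s * (1 / 4) + t * (1 / 4)"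
      using mult_left_mono[OF v(1) st(1)] mult_left_mono[OF v'(1) st(2)] st
      by (intro norm_triangle_mono) simp_all
    finally have "norm (real n *\<^sub>R (s *\<^sub>R w + t *\<^sub>R w') - j (s *\<^sub>R v + t *\<^sub>R v')) \<le> 1 / 4"
      using st by (simp add: distrib_right[symmetric])
    moreover have "blinfun_apply (column_tail_sum m l) (s *\<^sub>R v + t *\<^sub>R v') = 1"
      using v v' st by (simp add: blinfun.add_right blinfun.scaleR_right)
    ultimately show "s *\<^sub>R w + t *\<^sub>R w' \<in> D l" by (auto simp: D_def)
  qed
  have "\<kappa> ` {l..} \<subseteq> D l" for l
  proof
    fix w assume "w \<in> \<kappa> ` {l..}"
    then obtain k where k: "w = \<kappa> k" "l \<le> k" by auto
    then have "l \<le> e k" using e(2)[of k] by simp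
    then show "w \<in> D l" using \<kappa>(2)[of k] column_tail_sum(3)[of l "e k" m] k by (auto simp: D_def)
  qed
  then have hull: "convex hull (\<kappa> ` {l..}) \<subseteq> D l" for l
    using convex by (intro hull_minimal)
  have approx: "\<exists>v. norm (j v - real n *\<^sub>R z) < 3 / 8 \<and> blinfun_apply (column_tail_sum m l) v = 1" for l
  proof -
    \<comment> \<open>After scaling by \<open>n\<close>, the error is below \<open>1 / 8\<close>,
      also for \<open>n = 0\<close>; with the \<open>1 / 4\<close> from \<open>D l\<close> it stays
      below \<open>3 / 8\<close>.\<close>
    obtain c where c: "c \<in> convex hull (\<kappa> ` {l..})" "norm (c - z) < 1 / (8 * (real n + 1))"
      using mazur_approx[OF z, of "1 / (8 * (real n + 1))" l] by auto
    then obtain v where v: "norm (real n *\<^sub>R c - j v) \<le> 1 / 4" "blinfun_apply (column_tail_sum m l) v = 1"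
      using hull[of l] by (auto simp: D_def)
    have "real n * norm (c - z) \<le> real n * (1 / (8 * (real n + 1)))"
      using c by (intro mult_left_mono) auto
    also have "\<dots> < 1 / 8" by (simp add: field_simps)
    finally have "norm (real n *\<^sub>R c - real n *\<^sub>R z) < 1 / 8"
      by (simp add: scaleR_diff_right[symmetric])
    moreover have "norm (j v - real n *\<^sub>R z) \<le> norm (j v - real n *\<^sub>R c) + norm (real n *\<^sub>R c - real n *\<^sub>R z)"
      using norm_triangle_ineq[of "j v - real n *\<^sub>R c" "real n *\<^sub>R c - real n *\<^sub>R z"] by simp
    moreover have "norm (j v - real n *\<^sub>R c) \<le> 1 / 4" using v(1) by (simp only: norm_minus_commute)
    ultimately have "norm (j v - real n *\<^sub>R z) < 3 / 8" by linarith
    then show ?thesis using v(2) by blast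
  qed
  obtain v where v: "norm (j v - real n *\<^sub>R z) < 3 / 8" using approx[of 0] by blast
  \<comment> \<open>The index \<open>l\<close> depends on \<open>v\<close>: the tail sum is below
    \<open>1 / 4\<close> in modulus at \<open>v\<close> and equal to \<open>1\<close> at
    \<open>v'\<close>, while \<open>norm (v' - v)\<close> is below \<open>3 / 4\<close>.\<close>
  obtain l where l: "norm (proj ({m} \<times> {l..}) v) < 1 / 4"
    using proj_tail_eventually_small[of "1 / 4" m v] by (auto simp: eventually_sequentially)
  obtain v' where v': "norm (j v' - real n *\<^sub>R z) < 3 / 8" "blinfun_apply (column_tail_sum m l) v' = 1"
    using approx[of l] by blast
  have "norm (v' - v) = norm (j v' - j v)" by (simp add: j(2)[symmetric] linear_diff[OF j(1)])
  also have "\<dots> < 3 / 8 + 3 / 8"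
    using norm_triangle_ineq4[of "j v' - real n *\<^sub>R z" "j v - real n *\<^sub>R z"] v v'(1) by simp
  finally have "norm (v' - v) < 3 / 4" by simp
  moreover have "\<bar>blinfun_apply (column_tail_sum m l) (v' - v)\<bar> \<le> norm (v' - v)"
    using column_tail_sum(2)[of m l "v' - v"] norm_proj_le order_trans by blast
  moreover have "\<bar>blinfun_apply (column_tail_sum m l) v\<bar> < 1 / 4"
    using column_tail_sum(2)[of m l v] l by linarith
  ultimately show False using v'(2) by (simp add: blinfun.diff_right)
qed

text \<open>At the single accuracy \<open>1 / 4\<close>, the preimages \<open>G n\<close> form a
  countable family with finitely many unit vectors in each column, so the diagonal set escapes all
  of them.\<close>

lemma not_SWCG_wrt_l2_sum_ell1:
  fixes j :: "ell1 l2_sum \<Rightarrow> 'z::banach"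
  assumes "isometric_embedding j"
  shows "\<not> SWCG_wrt j"
proof
  assume "SWCG_wrt j"
  then obtain K where K: "weakly_compact K"
    and abs: "\<forall>\<epsilon>>0. \<forall>L. weakly_compact L \<longrightarrow>
      (\<exists>n::nat. j ` L \<subseteq> {real n *\<^sub>R k + u | k u. k \<in> K \<and> u \<in> cball 0 \<epsilon>})"
    unfolding SWCG_wrt_def by blast
  define G where "G n = {x. j x \<in> {real n *\<^sub>R k + u | k u. k \<in> K \<and> u \<in> cball 0 (1 / 4)}}" for n :: nat
  have j: "linear j" "norm (j x) = norm x" for x
    using assms by (auto simp: isometric_embedding_def)
  have "finite {i. unit_vec (m, i) \<in> G n}" for n m
    using unit_vecs_near_weakly_compact[OF j K, of m n] by (simp add: G_def)
  then obtain L where L: "weakly_compact L" "\<And>n. \<not> L \<subseteq> G n"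
    using weakly_compact_not_absorbed[of G] by blast
  have "\<exists>n::nat. j ` L \<subseteq> {real n *\<^sub>R k + u | k u. k \<in> K \<and> u \<in> cball 0 (1 / 4)}"
    by (rule abs[rule_format, OF _ L(1)]) simp
  then obtain n :: nat where n: "j ` L \<subseteq> {real n *\<^sub>R k + u | k u. k \<in> K \<and> u \<in> cball 0 (1 / 4)}"
    by (rule exE)
  have "L \<subseteq> G n"
    unfolding G_def by (rule subsetI, rule CollectI, rule subsetD[OF n], rule imageI)
  with L(2) show False by blast
qed

theorem theorem2p25:
  shows "\<not> property_star TYPE(l2_sum_of_ell1) \<and>
    SWKA TYPE(l2_sum_of_ell1) \<and>
    weakly_sequentially_complete TYPE(l2_sum_of_ell1) \<and>
    (\<forall>j :: l2_sum_of_ell1 \<Rightarrow> 'z::banach. isometric_embedding j \<longrightarrow> \<not> SWCG_wrt j)"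
  using not_property_star_l2_sum_ell1 SWKA_l2_sum_ell1 weakly_sequentially_complete_l2_sum_ell1
    not_SWCG_wrt_l2_sum_ell1 by blast

end
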